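(* Let $\alpha\in(1,\infty)$ and let $B:\mathbb R\setminus\{0\}\to\mathbb R$ be an even function that is positive, decreasing and convex on $(0,\infty)$ and satisfies, for some $\varepsilon>0$, $B(t)=\dfrac1{t\ln^\alpha(1/t)}$ for all $t\in(0,\varepsilon)$. Then the product system corresponding to $B$ is unitless, i.e. it has no unit.
   Context: "Positive" and "decreasing" are understood in the weak sense. **FHS-spaces.** Two norms $\|\cdot\|_1,\|\cdot\|_2$ on a real linear space $H$, each turning $H$ into a separable Hilbert space, are FHS-equivalent if they define the same topology and there is a (finite or countable) sequence $(e_k)$ that is an orthogonal basis for both norms with $\sum_k(\lambda_k-1)^2<\infty$, where $\lambda_k=\|e_k\|_2/\|e_k\|_1$. An FHS-space is a real linear space $H$ together with a full FHS-equivalence class of such norms, called admissible norms. Subspaces are closed linear subspaces, with the inherited FHS structure. $H=H_1\oplus H_2$ (FHS sense) means: the subspaces $H_1,H_2$ span $H$ and are orthogonal in some admissible norm. An FHS-isomorphism is a linear bijection carrying admissible norms to admissible norms. **Square roots of measures.** A measure type space $(\Omega,\mathcal F,\mathcal P)$ is a measurable space with an equivalence class $\mathcal P$ (mutual absolute continuity) of probability measures, taken so that each is a Lebesgue–Rokhlin space; sub-$\sigma$-fields contain all negligible sets. $L_2(\Omega,\mathcal F,\mathcal P)$ is the complex Hilbert space of families $\psi=(\psi_P)_{P\in\mathcal P}$, $\psi_P\in L_2(\Omega,\mathcal F,P)$, with $\psi_{P_2}=\sqrt{dP_1/dP_2}\,\psi_{P_1}$ and $\langle\psi,\psi'\rangle=\int\psi_P\overline{\psi'_P}\,dP$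 (independent of $P$). Write $\psi_P=\psi/\sqrt P$, $\psi=\psi_P\sqrt P$. **Exponential.** For an FHS-space $E$ let $(\Omega,\mathcal F,\mathcal P)$ be a measure type space with a linear map $f\mapsto\xi_f$ from $E$ to (classes of) real measurable functions generating $\mathcal F$, such that for every admissible norm $\|\cdot\|$ there is $\gamma\in\mathcal P$ under which each $\xi_f$ has distribution $N(0,\|f\|^2)$. It exists and is unique up to isomorphism; put $\operatorname{Exp}(E)=L_2(\Omega,\mathcal F,\mathcal P)$. For a subspace $E_1\subset E$, with $\mathcal F_1$ the $\sigma$-field generated by $\xi_f$, $f\in E_1$, identify $\operatorname{Exp}(E_1)=L_2(\Omega,\mathcal F_1,\mathcal P|_{\mathcal F_1})$. If $E=E_1\oplus E_2$ (FHS sense), then some $P\in\mathcal P$ makes $\mathcal F_1,\mathcal F_2$ independent, and $\operatorname{Exp}(E)=\operatorname{Exp}(E_1)\otimes\operatorname{Exp}(E_2)$ via $(f_1\sqrt{P|_{\mathcal F_1}})\otimes(f_2\sqrt{P|_{\mathcal F_2}})=f_1f_2\sqrt P$ (independent of the choice of such $P$). An FHS-isomorphism $U:E\to E'$ induces, via $\xi_f\mapsto\xi_{Uf}$, a unitary $\operatorname{Exp}(U):\operatorname{Exp}(E)\to\operatorname{Exp}(E')$. **The product system of $B$.** For $-\infty<a<b<\infty$ let $G_{a,b}$ be the completion of real $L_2(a,b)$ under $\langle f,g\rangle=\iint f(s)g(t)B(s-t)\,ds\,dt$, regarded as an FHS-space whose admissible norms are those FHS-equivalent to the given norm; $G_{a,b}\subset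 G_{a',b'}$ when $(a,b)\subset(a',b')$. Let $U_t:G_{a,b}\to G_{a+t,b+t}$ be the extension by continuity of $(U_tf)(s)=f(s-t)$. One has $G_{a,c}=G_{a,b}\oplus G_{b,c}$ in the FHS sense for $a<b<c$. Put $H_{a,b}=\operatorname{Exp}(G_{a,b})$; then $H_{a,c}=H_{a,b}\otimes H_{b,c}$ for $a<b<c$, and the unitaries $\operatorname{Exp}(U_t|_{G_{a,b}}):H_{a,b}\to H_{a+t,b+t}$ give the identification $H_{0,s+t}=H_{0,s}\otimes\operatorname{Exp}(U_s|_{G_{0,t}})H_{0,t}$. These data form the product system corresponding to $B$. **Unit.** A unit is a family of nonzero vectors $\psi_{a,b}\in H_{a,b}$ ($-\infty<a<b<\infty$) with $\psi_{a,b}\otimes\psi_{b,c}=\psi_{a,c}$ whenever $a<b<c$. *)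

theory Defs
  imports "HOL-Probability.Probability"
begin

section \<open>FHS-equivalence of norms\<close>

text \<open>
  A norm on a linear subspace \<open>H\<close> of a real vector space is a function \<open>N\<close> on the ambient type of
  which only the values on \<open>H\<close> matter.  The scalar product of a Hilbert norm is recovered by
  polarization.
\<close>

definition polar :: "('v::real_vector \<Rightarrow> real) \<Rightarrow> 'v \<Rightarrow> 'v \<Rightarrow> real" where
  "polar N x y = ((N (x + y))\<^sup>2 - (N (x - y))\<^sup>2) / 4"

text \<open>The value \<open>0\<close> off \<open>H\<close> makes this a metric in the sense of \<^locale>\<open>Metric_space\<close>, whose axioms
  of nonnegativity and symmetry are not relativized to the carrier.\<close>

definition norm_dist :: "'v::real_vector set \<Rightarrow> ('v \<Rightarrow> real) \<Rightarrow> 'v \<Rightarrow> 'v \<Rightarrow> real" where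
  "norm_dist H N x y = (if x \<in> H \<and> y \<in> H then N (x - y) else 0)"

definition norm_topology :: "'v::real_vector set \<Rightarrow> ('v \<Rightarrow> real) \<Rightarrow> 'v topology" where
  "norm_topology H N = Metric_space.mtopology H (norm_dist H N)"

definition separable_hilbert_norm :: "'v::real_vector set \<Rightarrow> ('v \<Rightarrow> real) \<Rightarrow> bool" where
  "separable_hilbert_norm H N \<longleftrightarrow>
     subspace H \<and>
     (\<forall>x\<in>H. \<forall>y\<in>H. polar N x y = polar N y x) \<and>
     (\<forall>x\<in>H. \<forall>y\<in>H. \<forall>z\<in>H. polar N (x + y) z = polar N x z + polar N y z) \<and>
     (\<forall>c. \<forall>x\<in>H. \<forall>y\<in>H. polar N (c *\<^sub>R x) y = c * polar N x y) \<and>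
     (\<forall>x\<in>H. x \<noteq> 0 \<longrightarrow> polar N x x > 0) \<and>
     (\<forall>x\<in>H. N x = sqrt (polar N x x)) \<and>
     Metric_space.mcomplete H (norm_dist H N) \<and>
     separable_space (norm_topology H N)"

definition orthogonal_basis ::
  "'v::real_vector set \<Rightarrow> ('v \<Rightarrow> real) \<Rightarrow> nat set \<Rightarrow> (nat \<Rightarrow> 'v) \<Rightarrow> bool" where
  "orthogonal_basis H N I e \<longleftrightarrow>
     (\<forall>k\<in>I. e k \<in> H \<and> e k \<noteq> 0) \<and>
     (\<forall>j\<in>I. \<forall>k\<in>I. j \<noteq> k \<longrightarrow> polar N (e j) (e k) = 0) \<and>
     norm_topology H N closure_of span (e ` I) = H"

text \<open>The index set \<open>I\<close> covers finite and infinite sequences at once.\<close>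

definition FHS_equivalent ::
  "'v::real_vector set \<Rightarrow> ('v \<Rightarrow> real) \<Rightarrow> ('v \<Rightarrow> real) \<Rightarrow> bool" where
  "FHS_equivalent H N1 N2 \<longleftrightarrow>
     separable_hilbert_norm H N1 \<and> separable_hilbert_norm H N2 \<and>
     norm_topology H N1 = norm_topology H N2 \<and>
     (\<exists>I e. orthogonal_basis H N1 I e \<and> orthogonal_basis H N2 I e \<and>
        (\<lambda>k. (N2 (e k) / N1 (e k) - 1)\<^sup>2) summable_on I)"

section \<open>Measure type spaces and square roots of measures\<close>

text \<open>
  A class of mutually absolutely continuous probability measures is given by one of its members.
  All notions below depend on \<open>M\<close> only through \<open>measure_type M\<close>.
\<close>

definition measure_type :: "'w measure \<Rightarrow> 'w measure set" where
  "measure_type M = {P. prob_space P \<and> sets P = sets M \<and>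
     absolutely_continuous M P \<and> absolutely_continuous P M}"

text \<open>Lebesgue--Rokhlin (standard) probability spaces: complete, and isomorphic modulo null sets to
  the completion of a Borel probability measure on the line.\<close>

definition lebesgue_rokhlin :: "'w measure \<Rightarrow> bool" where
  "lebesgue_rokhlin P \<longleftrightarrow> prob_space P \<and> complete_measure P \<and>
     (\<exists>(\<mu> :: real measure) A A' h.
        prob_space \<mu> \<and> sets \<mu> = sets borel \<and>
        A \<in> sets P \<and> emeasure P A = 1 \<and>
        A' \<in> sets (completion \<mu>) \<and> emeasure (completion \<mu>) A' = 1 \<and>
        bij_betw h A A' \<and>
        (\<forall>S\<subseteq>A. S \<in> sets P \<longleftrightarrow> h ` S \<in> sets (completion \<mu>)) \<and>
        (\<forall>S\<subseteq>A. S \<in> sets P \<longrightarrow> emeasure P S = emeasure (completion \<mu>) (h ` S)))"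

definition measure_type_space :: "'w measure \<Rightarrow> bool" where
  "measure_type_space M \<longleftrightarrow> prob_space M \<and> (\<forall>P\<in>measure_type M. lebesgue_rokhlin P)"

text \<open>
  Vectors of \<open>L\<^sub>2(\<Omega>, \<F>, \<P>)\<close> are families \<open>(\<psi>\<^sub>P)\<close> indexed by the measures of the given type.  Every
  \<open>\<psi>\<^sub>P\<close> is a representative of its class in \<open>L\<^sub>2(P)\<close>; equality of vectors is therefore
  \<open>vec_eq\<close>, and not equality of families.  The density of \<open>P\<^sub>1\<close> with respect to \<open>P\<^sub>2\<close> is
  \<open>RN_deriv P\<^sub>2 P\<^sub>1\<close>.
\<close>

definition sqrt_density :: "'w measure \<Rightarrow> 'w measure \<Rightarrow> 'w \<Rightarrow> real" where
  "sqrt_density P1 P2 x = sqrt (enn2real (RN_deriv P2 P1 x))"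

type_synonym 'w sqrt_vec = "'w measure \<Rightarrow> 'w \<Rightarrow> complex"

definition L2_vecs :: "'w measure \<Rightarrow> 'w sqrt_vec set" where
  "L2_vecs M = {\<psi>.
     (\<forall>P\<in>measure_type M. \<psi> P \<in> borel_measurable P \<and> integrable P (\<lambda>x. (cmod (\<psi> P x))\<^sup>2)) \<and>
     (\<forall>P1\<in>measure_type M. \<forall>P2\<in>measure_type M.
        AE x in P2. \<psi> P2 x = complex_of_real (sqrt_density P1 P2 x) * \<psi> P1 x)}"

definition vec_eq :: "'w measure \<Rightarrow> 'w sqrt_vec \<Rightarrow> 'w sqrt_vec \<Rightarrow> bool" where
  "vec_eq M \<psi> \<psi>' \<longleftrightarrow> (\<forall>P\<in>measure_type M. AE x in P. \<psi> P x = \<psi>' P x)"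

text \<open>The vector \<open>f \<surd>P\<close>.\<close>

definition times_sqrt :: "('w \<Rightarrow> complex) \<Rightarrow> 'w measure \<Rightarrow> 'w sqrt_vec" where
  "times_sqrt f P = (\<lambda>Q x. complex_of_real (sqrt_density P Q x) * f x)"

text \<open>
  \<open>is_tensor M F1 F2 \<psi>1 \<psi>2 \<psi>\<close> says \<open>\<psi>1 \<otimes> \<psi>2 = \<psi>\<close>, where \<open>F1\<close>, \<open>F2\<close> are sub-\<open>\<sigma>\<close>-fields of \<open>M\<close>
  and \<open>\<psi>1\<close>, \<open>\<psi>2\<close>, \<open>\<psi>\<close> are vectors over \<open>F1\<close>, \<open>F2\<close>, \<open>M\<close>: with \<open>\<psi>i = fi \<surd>(P|Fi)\<close>, that is,
  \<open>fi = \<psi>i (P|Fi)\<close>, the product is \<open>f1 f2 \<surd>P\<close>.  It does not depend on the choice of a measure \<open>P\<close>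
  of the given type that makes \<open>F1\<close> and \<open>F2\<close> independent.
\<close>

definition is_tensor ::
  "'w measure \<Rightarrow> 'w measure \<Rightarrow> 'w measure \<Rightarrow> 'w sqrt_vec \<Rightarrow> 'w sqrt_vec \<Rightarrow> 'w sqrt_vec \<Rightarrow> bool" where
  "is_tensor M F1 F2 \<psi>1 \<psi>2 \<psi> \<longleftrightarrow>
     (\<exists>P\<in>measure_type M.
        prob_space.indep_set P (sets F1) (sets F2) \<and>
        vec_eq M \<psi>
          (times_sqrt (\<lambda>x. \<psi>1 (restr_to_subalg P F1) x * \<psi>2 (restr_to_subalg P F2) x) P))"

section \<open>Gaussian type spaces over FHS-spaces\<close>

text \<open>The \<open>\<sigma>\<close>-field generated by the \<open>\<xi>\<^sub>f\<close>, \<open>f \<in> E\<close>, and by all negligible sets.  It does not depend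
  on the choice of the functions \<open>\<xi>\<^sub>f\<close> in their classes.\<close>

definition gen_field :: "'w measure \<Rightarrow> ('v \<Rightarrow> 'w \<Rightarrow> real) \<Rightarrow> 'v set \<Rightarrow> 'w measure" where
  "gen_field M \<xi> E =
     sigma (space M) ({\<xi> f -` S \<inter> space M | f S. f \<in> E \<and> S \<in> sets borel} \<union> null_sets M)"

definition centered_normal :: "real \<Rightarrow> real measure" where
  "centered_normal \<sigma> =
     (if \<sigma> = 0 then return borel 0 else density lborel (\<lambda>x. ennreal (normal_density 0 \<sigma> x)))"

text \<open>
  The measure type of \<open>M\<close> with \<open>\<xi>\<close> is the one that defines the exponential of the FHS-space \<open>E\<close> whose
  admissible norms form the set \<open>adm\<close>.  The Lebesgue--Rokhlin property is not part of this definition,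
  since it is only required of the big space when \<open>M\<close> is a sub-\<open>\<sigma>\<close>-field.
\<close>

definition gaussian_type ::
  "'v::real_vector set \<Rightarrow> ('v \<Rightarrow> real) set \<Rightarrow> 'w measure \<Rightarrow> ('v \<Rightarrow> 'w \<Rightarrow> real) \<Rightarrow> bool" where
  "gaussian_type E adm M \<xi> \<longleftrightarrow>
     prob_space M \<and>
     (\<forall>f\<in>E. \<xi> f \<in> borel_measurable M) \<and>
     (\<forall>f\<in>E. \<forall>g\<in>E. \<forall>c d. AE x in M. \<xi> (c *\<^sub>R f + d *\<^sub>R g) x = c * \<xi> f x + d * \<xi> g x) \<and>
     sets M = sets (gen_field M \<xi> E) \<and>
     (\<forall>N\<in>adm. \<exists>\<gamma>\<in>measure_type M. \<forall>f\<in>E. distr \<gamma> borel (\<xi> f) = centered_normal (N f))"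

section \<open>The product system of a covariance function\<close>

definition L2_interval :: "real \<Rightarrow> real \<Rightarrow> (real \<Rightarrow> real) set" where
  "L2_interval a b = {f. f \<in> borel_measurable borel \<and> integrable lborel (\<lambda>x. (f x)\<^sup>2) \<and>
     (\<forall>x. x \<notin> {a<..<b} \<longrightarrow> f x = 0)}"

definition L2_bounded :: "(real \<Rightarrow> real) set" where
  "L2_bounded = (\<Union>a. \<Union>b. L2_interval a b)"

text \<open>
  The spaces \<open>G\<^sub>a\<^sub>,\<^sub>b\<close> are completions of \<open>L2_interval a b\<close>, and \<open>G\<^sub>a\<^sub>,\<^sub>b \<subseteq> G\<^sub>a\<^sub>'\<^sub>,\<^sub>b\<^sub>'\<close> for
  \<open>(a,b) \<subseteq> (a',b')\<close>.  All of them are realized inside one Hilbert space (the type \<open>'g\<close>), through a linear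
  map \<open>J\<close> that transforms the form given by \<open>B\<close> into the scalar product; the completion is the
  closure of the image.
\<close>

definition isometric_embedding ::
  "(real \<Rightarrow> real) \<Rightarrow> ((real \<Rightarrow> real) \<Rightarrow> 'g::{real_inner, complete_space}) \<Rightarrow> bool" where
  "isometric_embedding B J \<longleftrightarrow>
     (\<forall>f\<in>L2_bounded. \<forall>g\<in>L2_bounded. \<forall>c d.
        J (\<lambda>x. c * f x + d * g x) = c *\<^sub>R J f + d *\<^sub>R J g) \<and>
     (\<forall>f\<in>L2_bounded. \<forall>g\<in>L2_bounded.
        J f \<bullet> J g = (LINT s|lborel. LINT t|lborel. f s * g t * B (s - t)))"

definition G_space ::
  "((real \<Rightarrow> real) \<Rightarrow> 'g::{real_inner, complete_space}) \<Rightarrow> real \<Rightarrow> real \<Rightarrow> 'g set" where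
  "G_space J a b = closure (J ` L2_interval a b)"

definition G_admissible ::
  "((real \<Rightarrow> real) \<Rightarrow> 'g::{real_inner, complete_space}) \<Rightarrow> real \<Rightarrow> real \<Rightarrow> ('g \<Rightarrow> real) set" where
  "G_admissible J a b = {N. FHS_equivalent (G_space J a b) norm N}"

definition G_field ::
  "((real \<Rightarrow> real) \<Rightarrow> 'g::{real_inner, complete_space}) \<Rightarrow> 'w measure \<Rightarrow> ('g \<Rightarrow> 'w \<Rightarrow> real) \<Rightarrow>
    real \<Rightarrow> real \<Rightarrow> 'w measure" where
  "G_field J M \<xi> a b = gen_field M \<xi> (G_space J a b)"

definition G_measure ::
  "((real \<Rightarrow> real) \<Rightarrow> 'g::{real_inner, complete_space}) \<Rightarrow> 'w measure \<Rightarrow> ('g \<Rightarrow> 'w \<Rightarrow> real) \<Rightarrow>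
    real \<Rightarrow> real \<Rightarrow> 'w measure" where
  "G_measure J M \<xi> a b = restr_to_subalg M (G_field J M \<xi> a b)"

text \<open>
  One measure type space carries all the \<open>\<xi>\<^sub>f\<close>, so that every \<open>Exp(G\<^sub>a\<^sub>,\<^sub>b)\<close> is realized over its
  sub-\<open>\<sigma>\<close>-field \<open>G_field J M \<xi> a b\<close>, compatibly with the inclusions of these spaces.
\<close>

definition product_system_of ::
  "(real \<Rightarrow> real) \<Rightarrow> ((real \<Rightarrow> real) \<Rightarrow> 'g::{real_inner, complete_space}) \<Rightarrow>
    'w measure \<Rightarrow> ('g \<Rightarrow> 'w \<Rightarrow> real) \<Rightarrow> bool" where
  "product_system_of B J M \<xi> \<longleftrightarrow>
     isometric_embedding B J \<and>
     measure_type_space M \<and>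
     (\<forall>a b. a < b \<longrightarrow> (\<forall>f\<in>G_space J a b. \<xi> f \<in> borel_measurable M)) \<and>
     (\<forall>a b. a < b \<longrightarrow>
        gaussian_type (G_space J a b) (G_admissible J a b) (G_measure J M \<xi> a b) \<xi>)"

text \<open>The Hilbert space \<open>H\<^sub>a\<^sub>,\<^sub>b = Exp(G\<^sub>a\<^sub>,\<^sub>b)\<close>.\<close>

definition H_space ::
  "((real \<Rightarrow> real) \<Rightarrow> 'g::{real_inner, complete_space}) \<Rightarrow> 'w measure \<Rightarrow> ('g \<Rightarrow> 'w \<Rightarrow> real) \<Rightarrow>
    real \<Rightarrow> real \<Rightarrow> 'w sqrt_vec set" where
  "H_space J M \<xi> a b = L2_vecs (G_measure J M \<xi> a b)"

text \<open>The time shifts, though part of the data of the product system, do not enter the notion of a unit: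
  it only involves the spaces \<open>H\<^sub>a\<^sub>,\<^sub>b\<close> and the tensor products.\<close>

definition is_system_unit ::
  "((real \<Rightarrow> real) \<Rightarrow> 'g::{real_inner, complete_space}) \<Rightarrow> 'w measure \<Rightarrow> ('g \<Rightarrow> 'w \<Rightarrow> real) \<Rightarrow>
    (real \<Rightarrow> real \<Rightarrow> 'w sqrt_vec) \<Rightarrow> bool" where
  "is_system_unit J M \<xi> \<psi> \<longleftrightarrow>
     (\<forall>a b. a < b \<longrightarrow>
        \<psi> a b \<in> H_space J M \<xi> a b \<and> \<not> vec_eq (G_measure J M \<xi> a b) (\<psi> a b) (\<lambda>P x. 0)) \<and>
     (\<forall>a b c. a < b \<longrightarrow> b < c \<longrightarrow>
        is_tensor (G_measure J M \<xi> a c) (G_field J M \<xi> a b) (G_field J M \<xi> b c)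
          (\<psi> a b) (\<psi> b c) (\<psi> a c))"

end

theory Submission
  imports Defs
begin

text \<open>
  For a unit \<open>\<psi>\<close>, the normalized measure \<open>\<mu> = |\<psi>\<^sub>0\<^sub>,\<^sub>1|\<^sup>2\<close> is absolutely continuous with respect to the Gaussian
  type, and the \<open>\<sigma>\<close>-fields of the intervals \<open>(i/n, (i+1)/n)\<close> are independent under \<open>\<mu>\<close>.  Let \<open>\<gamma>\<close> be the
  Gaussian measure that belongs to the given norm, let \<open>n = 2m\<close>, let \<open>X\<^sub>i\<close> be the Gaussian variable of the
  indicator of the \<open>i\<close>-th interval multiplied by \<open>(n/C)\<^sup>1\<^sup>/\<^sup>2\<close>, where \<open>C\<close> bounds the integral of \<open>B\<close> over
  \<open>(-1, 1)\<close>, let \<open>\<theta>\<^sub>i = sin X\<^sub>i\<close>, and consider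
    \<open>W = \<Sum>\<^sub>k \<theta>\<^sub>2\<^sub>k \<theta>\<^sub>2\<^sub>k\<^sub>+\<^sub>1 - \<Sum>\<^sub>i \<epsilon>\<^sub>i \<theta>\<^sub>i\<close>,
  where \<open>\<epsilon>\<^sub>i\<close> is the sign of the \<open>\<mu>\<close>-mean of \<open>\<theta>\<^sub>i\<close>.  By independence and \<open>|\<theta>\<^sub>i| \<le> 1\<close>, under \<open>\<mu>\<close> the mean
  of \<open>W\<close> is at most \<open>0\<close> and its variance is \<open>O(n)\<close>.  Under \<open>\<gamma>\<close> the variance is also \<open>O(n)\<close>, because the
  covariances of the \<open>X\<^sub>i\<close> are positive with sum at most \<open>n\<close>, whereas the mean is at least a constant times
  \<open>B (1/m)\<close>, since neighbouring \<open>X\<^sub>i\<close> are correlated.  As \<open>B (1/m)\<^sup>2 / m = m / ln\<^sup>2\<^sup>\<alpha> m\<close> is unbounded, Chebyshev's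
  inequality and the Borel--Cantelli lemma show that \<open>\<mu>\<close> and \<open>\<gamma>\<close> are mutually singular, a contradiction.
\<close>

section \<open>Variances of sums of bounded random variables\<close>

text \<open>Rescaling \<open>x\<close> to \<open>\<sigma> * x\<close> turns the integral into the
  characteristic function of the standard normal law at \<open>\<sigma>\<close>. For
  \<open>\<sigma> = 0\<close> the law is a point mass at 0 and is treated apart.\<close>

lemma centered_normal_iexp:
  assumes "0 \<le> \<sigma>"
  shows "(CLINT x|centered_normal \<sigma>. iexp x) = exp (- \<sigma>\<^sup>2 / 2)"
proof (cases "\<sigma> = 0")
  case True
  then show ?thesis by (simp add: centered_normal_def integral_return)
next
  case False
  with assms have pos: "\<sigma> > 0" by simp
  have dens: "\<sigma> * normal_density 0 \<sigma> (0 + \<sigma> * x) = std_normal_density x" for x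
    using pos by (simp add: normal_density_def power_mult_distrib real_sqrt_mult)
  have "(CLINT x|centered_normal \<sigma>. iexp x)
      = (CLINT x|lborel. normal_density 0 \<sigma> x *\<^sub>R iexp x)"
    using pos by (simp add: centered_normal_def integral_density)
  also have "\<dots> = \<bar>\<sigma>\<bar> *\<^sub>R (CLINT x|lborel. normal_density 0 \<sigma> (0 + \<sigma> * x) *\<^sub>R iexp (0 + \<sigma> * x))"
    using pos by (intro lborel_integral_real_affine) auto
  also have "\<dots> = (CLINT x|lborel. std_normal_density x *\<^sub>R iexp (\<sigma> * x))"
    unfolding integral_scaleR_right[symmetric] scaleR_scaleR
    using pos dens by (intro Bochner_Integration.integral_cong refl) simp
  also have "\<dots> = char std_normal_distribution \<sigma>"
    unfolding char_def by (subst integral_density) auto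
  also have "\<dots> = exp (- \<sigma>\<^sup>2 / 2)" by (simp add: char_std_normal_distribution)
  finally show ?thesis .
qed

text \<open>The derivative of \<open>exp\<close> is at most 1 on the nonpositive half-line. This
  converts differences of Gaussian characteristic functions into differences of their exponents,
  that is, into inner products.\<close>

lemma abs_exp_diff_le:
  fixes x y :: real
  assumes "x \<le> 0" "y \<le> 0"
  shows "\<bar>exp x - exp y\<bar> \<le> \<bar>x - y\<bar>"
proof -
  have *: "exp y - exp x \<le> y - x" if "x \<le> y" "y \<le> 0" for x y :: real
  proof -
    have "exp y - exp x = exp y * (1 - exp (x - y))" by (simp add: algebra_simps flip: exp_add)
    also have "\<dots> \<le> 1 * (y - x)"
      using that exp_ge_add_one_self[of "x - y"] by (intro mult_mono) (simp_all add: algebra_simps)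
    finally show ?thesis by simp
  qed
  show ?thesis using *[of x y] *[of y x] assms by (cases "x \<le> y") auto
qed

lemma sum_lessThan_double:
  fixes f :: "nat \<Rightarrow> 'a::comm_monoid_add"
  shows "(\<Sum>i<2 * m. f i) = (\<Sum>k<m. f (2 * k) + f (2 * k + 1))"
  by (induction m) (simp_all add: add.assoc)

context prob_space
begin

lemma integrable_bounded_rv:
  fixes X :: "'a \<Rightarrow> real"
  assumes "X \<in> borel_measurable M" "\<And>x. \<bar>X x\<bar> \<le> c"
  shows "integrable M X"
  using assms by (intro integrable_const_bound[where B = c]) auto

lemma variance_sum_bounded:
  fixes X :: "'i \<Rightarrow> 'a \<Rightarrow> real"
  assumes fin: "finite I"
    and [measurable]: "\<And>i. i \<in> I \<Longrightarrow> X i \<in> borel_measurable M"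
    and bd: "\<And>i x. i \<in> I \<Longrightarrow> \<bar>X i x\<bar> \<le> 1"
  shows "variance (\<lambda>x. \<Sum>i\<in>I. X i x) =
    (\<Sum>i\<in>I. \<Sum>j\<in>I. expectation (\<lambda>x. X i x * X j x) - expectation (X i) * expectation (X j))"
proof -
  have int1: "integrable M (X i)" if "i \<in> I" for i
    using that bd by (intro integrable_bounded_rv[where c = 1]) auto
  have int2: "integrable M (\<lambda>x. X i x * X j x)" if "i \<in> I" "j \<in> I" for i j
  proof (rule integrable_bounded_rv[where c = 1])
    show "\<bar>X i x * X j x\<bar> \<le> 1" for x
      using mult_mono[OF bd[OF that(1)] bd[OF that(2)]] by (simp add: abs_mult)
  qed (use that in auto)
  have sq: "(\<lambda>x. (\<Sum>i\<in>I. X i x)\<^sup>2) = (\<lambda>x. \<Sum>i\<in>I. \<Sum>j\<in>I. X i x * X j x)"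
    by (simp add: power2_eq_square sum_product)
  have "variance (\<lambda>x. \<Sum>i\<in>I. X i x)
      = expectation (\<lambda>x. (\<Sum>i\<in>I. X i x)\<^sup>2) - (expectation (\<lambda>x. \<Sum>i\<in>I. X i x))\<^sup>2"
    using int1 int2 by (intro variance_eq) (simp_all add: sq)
  also have "\<dots> = (\<Sum>i\<in>I. \<Sum>j\<in>I. expectation (\<lambda>x. X i x * X j x)) -
      (\<Sum>i\<in>I. expectation (X i)) * (\<Sum>i\<in>I. expectation (X i))"
    unfolding sq using int1 int2 by (simp add: power2_eq_square)
  also have "\<dots> = (\<Sum>i\<in>I. \<Sum>j\<in>I. expectation (\<lambda>x. X i x * X j x) - expectation (X i) * expectation (X j))"
    by (simp add: sum_product sum_subtractf)
  finally show ?thesis .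
qed

text \<open>The inequality \<open>(p - q)^2 <= 2 * p^2 + 2 * q^2\<close>, applied to the centred
  variables, avoids any estimate of the covariance between \<open>X\<close> and
  \<open>Y\<close>.\<close>

lemma variance_diff_le:
  fixes X Y :: "'a \<Rightarrow> real"
  assumes [measurable]: "X \<in> borel_measurable M" "Y \<in> borel_measurable M"
    and bd: "\<And>x. \<bar>X x\<bar> \<le> c" "\<And>x. \<bar>Y x\<bar> \<le> d"
  shows "variance (\<lambda>x. X x - Y x) \<le> 2 * variance X + 2 * variance Y"
proof -
  have iX: "integrable M X" and iY: "integrable M Y"
    using bd by (auto intro!: integrable_bounded_rv)
  have sq: "integrable M (\<lambda>x. (Z x - a)\<^sup>2)"
    if [measurable]: "Z \<in> borel_measurable M" and "\<And>x. \<bar>Z x\<bar> \<le> e" for Z :: "'a \<Rightarrow> real" and a e :: real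
  proof (rule integrable_bounded_rv[where c = "(e + \<bar>a\<bar>)\<^sup>2"])
    show "\<bar>(Z x - a)\<^sup>2\<bar> \<le> (e + \<bar>a\<bar>)\<^sup>2" for x
      using that(2)[of x] by (auto intro!: power2_le_iff_abs_le[THEN iffD2])
  qed auto
  have "variance (\<lambda>x. X x - Y x)
      \<le> expectation (\<lambda>x. 2 * (X x - expectation X)\<^sup>2 + 2 * (Y x - expectation Y)\<^sup>2)"
  proof (rule integral_mono)
    show "integrable M (\<lambda>x. (X x - Y x - expectation (\<lambda>x. X x - Y x))\<^sup>2)"
      using bd by (intro sq[of _ "c + d"]) (auto intro: order_trans[OF abs_triangle_ineq4] add_mono)
    show "integrable M (\<lambda>x. 2 * (X x - expectation X)\<^sup>2 + 2 * (Y x - expectation Y)\<^sup>2)"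
      using sq[of X c "expectation X"] sq[of Y d "expectation Y"] bd by simp
    have "(p - q)\<^sup>2 \<le> 2 * p\<^sup>2 + 2 * q\<^sup>2" for p q :: real
      using zero_le_power2[of "p + q"] by (simp add: power2_sum power2_diff)
    from this[of "X x - expectation X" "Y x - expectation Y" for x]
    show "(X x - Y x - expectation (\<lambda>x. X x - Y x))\<^sup>2
        \<le> 2 * (X x - expectation X)\<^sup>2 + 2 * (Y x - expectation Y)\<^sup>2" for x
      using iX iY by (simp add: algebra_simps)
  qed
  also have "\<dots> = 2 * variance X + 2 * variance Y"
    using sq[of X c "expectation X"] sq[of Y d "expectation Y"] bd by simp
  finally show ?thesis .
qed

end

section \<open>The pair statistic and its size under independence\<close>

definition pair_statistic :: "nat \<Rightarrow> (nat \<Rightarrow> real) \<Rightarrow> (nat \<Rightarrow> 'w \<Rightarrow> real) \<Rightarrow> 'w \<Rightarrow> real" where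
  "pair_statistic m \<epsilon> \<theta> x = (\<Sum>k<m. \<theta> (2 * k) x * \<theta> (2 * k + 1) x) - (\<Sum>i<2 * m. \<epsilon> i * \<theta> i x)"

lemma pair_statistic_measurable [measurable]:
  assumes "\<And>i. i < 2 * m \<Longrightarrow> \<theta> i \<in> borel_measurable M"
  shows "pair_statistic m \<epsilon> \<theta> \<in> borel_measurable M"
  unfolding pair_statistic_def using assms by (auto intro!: borel_measurable_sum borel_measurable_diff borel_measurable_times)

context prob_space
begin

text \<open>Common starting point for both measures: the quadratic and the linear part are
  separated, and only covariances within each part remain to be bounded. The coefficients
  \<open>\<epsilon>\<close> stay arbitrary because they are chosen from one measure and used under
  both.\<close>

lemma variance_pair_statistic:
  fixes \<theta> :: "nat \<Rightarrow> 'a \<Rightarrow> real"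
  assumes [measurable]: "\<And>i. i < 2 * m \<Longrightarrow> \<theta> i \<in> borel_measurable M"
    and bd: "\<And>i x. \<bar>\<theta> i x\<bar> \<le> 1" and eps: "\<And>i. \<bar>\<epsilon> i\<bar> \<le> 1"
  defines "cov \<equiv> \<lambda>X Y. expectation (\<lambda>x. X x * Y x) - expectation X * expectation (Y :: 'a \<Rightarrow> real)"
  shows "variance (pair_statistic m \<epsilon> \<theta>) \<le>
      2 * (\<Sum>k<m. \<Sum>l<m. cov (\<lambda>x. \<theta> (2 * k) x * \<theta> (2 * k + 1) x) (\<lambda>x. \<theta> (2 * l) x * \<theta> (2 * l + 1) x)) +
      2 * (\<Sum>i<2 * m. \<Sum>j<2 * m. cov (\<lambda>x. \<epsilon> i * \<theta> i x) (\<lambda>x. \<epsilon> j * \<theta> j x))" (is "_ \<le> ?R")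
    and "expectation (pair_statistic m \<epsilon> \<theta>) =
      (\<Sum>k<m. expectation (\<lambda>x. \<theta> (2 * k) x * \<theta> (2 * k + 1) x)) -
      (\<Sum>i<2 * m. \<epsilon> i * expectation (\<theta> i))" (is "_ = ?E")
    and "integrable M (\<lambda>x. (pair_statistic m \<epsilon> \<theta> x)\<^sup>2)"
proof -
  let ?T = "\<lambda>x. \<Sum>k<m. \<theta> (2 * k) x * \<theta> (2 * k + 1) x"
  let ?Z = "\<lambda>x. \<Sum>i<2 * m. \<epsilon> i * \<theta> i x"
  have b2: "\<bar>\<theta> i x * \<theta> j x\<bar> \<le> 1" for i j x
    using mult_mono[OF bd[of i x] bd[of j x]] by (simp add: abs_mult)
  have be: "\<bar>\<epsilon> i * \<theta> i x\<bar> \<le> 1" for i x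
    using mult_mono[OF eps[of i] bd[of i x]] by (simp add: abs_mult)
  have bT: "\<bar>?T x\<bar> \<le> m" for x
    using sum_mono[of "{..<m}" "\<lambda>k. \<bar>\<theta> (2 * k) x * \<theta> (2 * k + 1) x\<bar>" "\<lambda>_. 1"] b2
    by (intro order_trans[OF sum_abs]) auto
  have bZ: "\<bar>?Z x\<bar> \<le> 2 * m" for x
    using sum_mono[of "{..<2 * m}" "\<lambda>i. \<bar>\<epsilon> i * \<theta> i x\<bar>" "\<lambda>_. 1"] be
    by (intro order_trans[OF sum_abs]) auto
  have "variance (pair_statistic m \<epsilon> \<theta>) \<le> 2 * variance ?T + 2 * variance ?Z"
    unfolding pair_statistic_def using bT bZ
    by (intro variance_diff_le) auto
  also have "\<dots> = ?R"
    unfolding cov_def using b2 be by (subst (1 2) variance_sum_bounded) auto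
  finally show "variance (pair_statistic m \<epsilon> \<theta>) \<le> ?R" .
  have i1: "integrable M (\<lambda>x. \<theta> i x * \<theta> j x)" if "i < 2 * m" "j < 2 * m" for i j
    using that b2 by (intro integrable_bounded_rv[where c = 1]) auto
  have i2: "integrable M (\<theta> i)" if "i < 2 * m" for i
    using that bd by (intro integrable_bounded_rv[where c = 1]) auto
  show "expectation (pair_statistic m \<epsilon> \<theta>) = ?E"
    unfolding pair_statistic_def using i1 i2
    by (subst Bochner_Integration.integral_diff) (auto intro!: Bochner_Integration.integrable_sum simp: Bochner_Integration.integral_sum)
  show "integrable M (\<lambda>x. (pair_statistic m \<epsilon> \<theta> x)\<^sup>2)"
  proof (rule integrable_bounded_rv[where c = "(real (3 * m))\<^sup>2"])
    have "\<bar>pair_statistic m \<epsilon> \<theta> x\<bar> \<le> real (3 * m)" for x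
      using bT[of x] bZ[of x] unfolding pair_statistic_def by simp
    then show "\<bar>(pair_statistic m \<epsilon> \<theta> x)\<^sup>2\<bar> \<le> (real (3 * m))\<^sup>2" for x
      by (simp only: abs_power2 power2_le_iff_abs_le)
  qed auto
qed

text \<open>Independence leaves only the diagonal covariances, and the choice of signs makes the
  mean nonpositive, so that reaching \<open>L\<close> requires a deviation of at least
  \<open>L\<close> from the mean. Chebyshev's inequality concludes.\<close>

lemma indep_vars_pair_statistic:
  fixes \<theta> :: "nat \<Rightarrow> 'a \<Rightarrow> real"
  assumes indep: "indep_vars (\<lambda>_. borel) \<theta> {..<2 * m}"
    and bd: "\<And>i x. \<bar>\<theta> i x\<bar> \<le> 1"
    and L: "0 < L"
  shows "prob {x \<in> space M. L \<le> pair_statistic m (\<lambda>i. sgn (expectation (\<theta> i))) \<theta> x} \<le> 6 * real m / L\<^sup>2"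
proof -
  let ?\<epsilon> = "\<lambda>i. sgn (expectation (\<theta> i))"
  let ?W = "pair_statistic m ?\<epsilon> \<theta>"
  have [measurable]: "\<theta> i \<in> borel_measurable M" if "i < 2 * m" for i
    using indep that by (auto simp: indep_vars_def)
  have b2: "\<bar>\<theta> i x * \<theta> j x\<bar> \<le> 1" for i j x
    using mult_mono[OF bd[of i x] bd[of j x]] by (simp add: abs_mult)
  have i1: "integrable M (\<theta> i)" if "i < 2 * m" for i
    using that bd by (intro integrable_bounded_rv[where c = 1]) auto
  have prod: "expectation (\<lambda>x. \<Prod>i\<in>I. \<theta> i x) = (\<Prod>i\<in>I. expectation (\<theta> i))"
    if "I \<subseteq> {..<2 * m}" for I
    using that i1 by (intro indep_vars_lebesgue_integral indep_vars_subset[OF indep] finite_subset[OF that]) auto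
  have e2: "expectation (\<lambda>x. \<theta> i x * \<theta> j x) = expectation (\<theta> i) * expectation (\<theta> j)"
    if "i < 2 * m" "j < 2 * m" "i \<noteq> j" for i j
    using prod[of "{i, j}"] that by simp
  have e4: "expectation (\<lambda>x. \<theta> (2*k) x * \<theta> (2*k+1) x * (\<theta> (2*l) x * \<theta> (2*l+1) x)) =
      expectation (\<lambda>x. \<theta> (2*k) x * \<theta> (2*k+1) x) * expectation (\<lambda>x. \<theta> (2*l) x * \<theta> (2*l+1) x)"
    if "k < m" "l < m" "k \<noteq> l" for k l
  proof -
    have "2 * k \<noteq> Suc (2 * l)" "2 * l \<noteq> Suc (2 * k)" by presburger+
    then show ?thesis
      using prod[of "{2*k, 2*k+1, 2*l, 2*l+1}"] that e2[of "2*k" "2*k+1"] e2[of "2*l" "2*l+1"]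
      by (simp add: mult.assoc)
  qed
  have le1: "expectation (\<lambda>x. X x * X x) - expectation X * expectation X \<le> 1"
    if [measurable]: "X \<in> borel_measurable M" and "\<And>x. \<bar>X x\<bar> \<le> 1" for X :: "'a \<Rightarrow> real"
  proof -
    have "\<bar>X x * X x\<bar> \<le> 1" for x using mult_mono[OF that(2)[of x] that(2)[of x]] by (simp add: abs_mult)
    then have "expectation (\<lambda>x. X x * X x) \<le> expectation (\<lambda>_. 1)"
      by (intro integral_mono integrable_bounded_rv[where c = 1]) (auto simp: abs_le_iff)
    then have "expectation (\<lambda>x. X x * X x) \<le> 1" by (simp add: prob_space)
    then show ?thesis using zero_le_square[of "expectation X"] by linarith
  qed
  have eps: "\<bar>?\<epsilon> i\<bar> \<le> 1" for i by (simp add: sgn_if)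
  have be: "\<bar>?\<epsilon> i * \<theta> i x\<bar> \<le> 1" for i x
    using mult_mono[OF eps[of i] bd[of i x]] by (simp add: abs_mult)
  have e2': "expectation (\<lambda>x. ?\<epsilon> i * \<theta> i x * (?\<epsilon> j * \<theta> j x)) =
      expectation (\<lambda>x. ?\<epsilon> i * \<theta> i x) * expectation (\<lambda>x. ?\<epsilon> j * \<theta> j x)"
    if "i < 2 * m" "j < 2 * m" "i \<noteq> j" for i j
  proof -
    have "expectation (\<lambda>x. ?\<epsilon> i * \<theta> i x * (?\<epsilon> j * \<theta> j x)) =
        ?\<epsilon> i * ?\<epsilon> j * expectation (\<lambda>x. \<theta> i x * \<theta> j x)"
      by (subst integral_mult_right_zero[symmetric]) (simp add: mult_ac)
    then show ?thesis using e2[OF that] by simp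
  qed
  \<comment> \<open>The diagonals have \<open>m\<close> and \<open>2 * m\<close> entries, each at
    most 1, which gives \<open>2 * m + 4 * m = 6 * m\<close>. Distinct pairs use four distinct
    indices, so their products are uncorrelated.\<close>
  have "variance ?W \<le> 2 * (\<Sum>k<m. \<Sum>l<m. if k = l then 1 else 0) + 2 * (\<Sum>i<2 * m. \<Sum>j<2 * m. if i = j then 1 else 0)"
  proof (intro order_trans[OF variance_pair_statistic(1)] add_mono mult_left_mono sum_mono bd eps)
    fix k l assume "k \<in> {..<m}" "l \<in> {..<m}"
    then show "expectation (\<lambda>x. \<theta> (2*k) x * \<theta> (2*k+1) x * (\<theta> (2*l) x * \<theta> (2*l+1) x)) -
        expectation (\<lambda>x. \<theta> (2*k) x * \<theta> (2*k+1) x) * expectation (\<lambda>x. \<theta> (2*l) x * \<theta> (2*l+1) x)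
        \<le> (if k = l then 1 else 0)"
      using e4[of k l] le1[of "\<lambda>x. \<theta> (2*k) x * \<theta> (2*k+1) x"] b2 by (cases "k = l") auto
  next
    fix i j assume "i \<in> {..<2 * m}" "j \<in> {..<2 * m}"
    then show "expectation (\<lambda>x. ?\<epsilon> i * \<theta> i x * (?\<epsilon> j * \<theta> j x)) -
        expectation (\<lambda>x. ?\<epsilon> i * \<theta> i x) * expectation (\<lambda>x. ?\<epsilon> j * \<theta> j x) \<le> (if i = j then 1 else 0)"
      using e2'[of i j] le1[of "\<lambda>x. ?\<epsilon> i * \<theta> i x"] be by (cases "i = j") auto
  qed auto
  also have "\<dots> = 6 * m" by simp
  finally have var: "variance ?W \<le> 6 * m" .
  have "expectation ?W = (\<Sum>k<m. expectation (\<theta> (2*k)) * expectation (\<theta> (2*k+1))) -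
      (\<Sum>i<2 * m. \<bar>expectation (\<theta> i)\<bar>)"
    by (subst variance_pair_statistic(2)[OF _ bd eps]) (auto simp: e2 mult.commute abs_sgn)
  also have "\<dots> = (\<Sum>k<m. expectation (\<theta> (2*k)) * expectation (\<theta> (2*k+1)) -
      \<bar>expectation (\<theta> (2*k))\<bar> - \<bar>expectation (\<theta> (2*k+1))\<bar>)"
    by (simp add: sum_lessThan_double sum_subtractf sum.distrib)
  \<comment> \<open>Each summand has the form \<open>a * b - |a| - |b|\<close> with
    \<open>|a| <= 1\<close>, hence \<open>a * b <= |b|\<close>. This is what the linear correction
    is for: it absorbs the means of the pair products.\<close>
  also have "\<dots> \<le> 0"
  proof (intro sum_nonpos)
    fix k assume "k \<in> {..<m}"
    have "\<bar>expectation (\<theta> (2*k))\<bar> \<le> 1"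
      using \<open>k \<in> {..<m}\<close> bd i1 integral_mono[of M "\<lambda>x. \<bar>\<theta> (2*k) x\<bar>" "\<lambda>_. 1"]
      by (intro order_trans[OF integral_abs_bound]) (auto simp: prob_space)
    then have "\<bar>expectation (\<theta> (2*k))\<bar> * \<bar>expectation (\<theta> (2*k+1))\<bar> \<le> 1 * \<bar>expectation (\<theta> (2*k+1))\<bar>"
      by (intro mult_right_mono) auto
    moreover have "expectation (\<theta> (2*k)) * expectation (\<theta> (2*k+1)) \<le>
        \<bar>expectation (\<theta> (2*k))\<bar> * \<bar>expectation (\<theta> (2*k+1))\<bar>"
      by (metis abs_ge_self abs_mult)
    ultimately show "expectation (\<theta> (2*k)) * expectation (\<theta> (2*k+1)) -
      \<bar>expectation (\<theta> (2*k))\<bar> - \<bar>expectation (\<theta> (2*k+1))\<bar> \<le> 0" by linarith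
  qed
  finally have mean: "expectation ?W \<le> 0" .
  have "prob {x \<in> space M. L \<le> ?W x} \<le> prob {x \<in> space M. L \<le> \<bar>?W x - expectation ?W\<bar>}"
    using mean by (intro finite_measure_mono) auto
  also have "\<dots> \<le> variance ?W / L\<^sup>2"
    using L variance_pair_statistic(3)[of m \<theta> ?\<epsilon>] bd eps
    by (intro Chebyshev_inequality) auto
  also have "\<dots> \<le> 6 * real m / L\<^sup>2" using var L by (intro divide_right_mono) auto
  finally show ?thesis .
qed

end

section \<open>Gaussian fields\<close>

text \<open>Only one-dimensional distributions are prescribed. Together with almost sure linearity
  they also determine the expectations of products of sines and cosines, through sums and
  differences of vectors.\<close>

locale gaussian_field = prob_space P
  for P :: "'w measure" and E :: "'g::real_inner set" and \<xi> :: "'g \<Rightarrow> 'w \<Rightarrow> real" +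
  assumes subspace: "subspace E"
    and \<xi>_measurable [measurable]: "f \<in> E \<Longrightarrow> \<xi> f \<in> borel_measurable P"
    and \<xi>_linear: "f \<in> E \<Longrightarrow> g \<in> E \<Longrightarrow> AE x in P. \<xi> (c *\<^sub>R f + d *\<^sub>R g) x = c * \<xi> f x + d * \<xi> g x"
    and distr_\<xi>: "f \<in> E \<Longrightarrow> distr P borel (\<xi> f) = centered_normal (norm f)"
begin

lemma expectation_iexp:
  assumes "f \<in> E"
  shows "(CLINT x|P. iexp (\<xi> f x)) = exp (- (norm f)\<^sup>2 / 2)"
proof -
  have "(CLINT x|P. iexp (\<xi> f x)) = (CLINT x|distr P borel (\<xi> f). iexp x)"
    using assms by (intro integral_distr[symmetric]) auto
  then show ?thesis using assms by (simp add: distr_\<xi> centered_normal_iexp)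
qed

lemma integrable_iexp: "f \<in> E \<Longrightarrow> integrable P (\<lambda>x. iexp (\<xi> f x))"
  by (intro integrable_const_bound[where B = 1]) auto

lemma expectation_cos: "f \<in> E \<Longrightarrow> expectation (\<lambda>x. cos (\<xi> f x)) = exp (- (norm f)\<^sup>2 / 2)"
  using integral_Re[OF integrable_iexp[of f]] by (simp add: expectation_iexp Re_exp)

lemma expectation_sin: "f \<in> E \<Longrightarrow> expectation (\<lambda>x. sin (\<xi> f x)) = 0"
  using integral_Im[OF integrable_iexp[of f]] by (simp add: expectation_iexp Im_exp)

lemma \<xi>_add: "f \<in> E \<Longrightarrow> g \<in> E \<Longrightarrow> AE x in P. \<xi> (f + g) x = \<xi> f x + \<xi> g x"
  using \<xi>_linear[of f g 1 1] by simp

lemma \<xi>_diff: "f \<in> E \<Longrightarrow> g \<in> E \<Longrightarrow> AE x in P. \<xi> (f - g) x = \<xi> f x - \<xi> g x"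
  using \<xi>_linear[of f g 1 "-1"] by simp

lemma integrable_cos: "f \<in> E \<Longrightarrow> integrable P (\<lambda>x. cos (\<xi> f x))"
  by (intro integrable_bounded_rv[where c = 1]) auto

text \<open>The product-to-sum formulas reduce two-variable expectations to characteristic functions
  of single variables. They hold almost surely only, since \<open>\<xi>\<close> is linear only up to
  null sets.\<close>

lemma
  assumes "f \<in> E" "g \<in> E"
  shows cos_times_cos_AE: "AE x in P. cos (\<xi> f x) * cos (\<xi> g x) = (cos (\<xi> (f - g) x) + cos (\<xi> (f + g) x)) / 2"
    and sin_times_sin_AE: "AE x in P. sin (\<xi> f x) * sin (\<xi> g x) = (cos (\<xi> (f - g) x) - cos (\<xi> (f + g) x)) / 2"
  using \<xi>_add[OF assms] \<xi>_diff[OF assms]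
  by (auto elim!: eventually_elim2 simp: cos_times_cos sin_times_sin)

lemma sum_diff_mem: "f \<in> E \<Longrightarrow> g \<in> E \<Longrightarrow> f + g \<in> E" "f \<in> E \<Longrightarrow> g \<in> E \<Longrightarrow> f - g \<in> E"
  using subspace by (auto intro: subspace_add subspace_diff)

lemma expectation_cos_cos:
  assumes "f \<in> E" "g \<in> E"
  shows "expectation (\<lambda>x. cos (\<xi> f x) * cos (\<xi> g x)) =
    (exp (- (norm (f - g))\<^sup>2 / 2) + exp (- (norm (f + g))\<^sup>2 / 2)) / 2"
proof -
  have "expectation (\<lambda>x. cos (\<xi> f x) * cos (\<xi> g x)) =
      expectation (\<lambda>x. (cos (\<xi> (f - g) x) + cos (\<xi> (f + g) x)) / 2)"
    using cos_times_cos_AE[OF assms] assms sum_diff_mem by (intro integral_cong_AE) auto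
  then show ?thesis using assms sum_diff_mem by (simp add: integrable_cos expectation_cos)
qed

lemma expectation_sin_sin:
  assumes "f \<in> E" "g \<in> E"
  shows "expectation (\<lambda>x. sin (\<xi> f x) * sin (\<xi> g x)) =
    (exp (- (norm (f - g))\<^sup>2 / 2) - exp (- (norm (f + g))\<^sup>2 / 2)) / 2"
proof -
  have "expectation (\<lambda>x. sin (\<xi> f x) * sin (\<xi> g x)) =
      expectation (\<lambda>x. (cos (\<xi> (f - g) x) - cos (\<xi> (f + g) x)) / 2)"
    using sin_times_sin_AE[OF assms] assms sum_diff_mem by (intro integral_cong_AE) auto
  then show ?thesis using assms sum_diff_mem by (simp add: integrable_cos expectation_cos)
qed

text \<open>Put \<open>s = - (|f|^2 + |g|^2) / 2\<close> with norms for bars. The three exponentials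
  involved have exponents \<open>s + f \<bullet> g\<close>, \<open>s - f \<bullet> g\<close> and
  \<open>s\<close>, all nonpositive, so the Lipschitz bound for \<open>exp\<close> applies to both
  differences.\<close>

lemma cov_cos_le:
  assumes "f \<in> E" "g \<in> E"
  shows "\<bar>expectation (\<lambda>x. cos (\<xi> f x) * cos (\<xi> g x)) -
    expectation (\<lambda>x. cos (\<xi> f x)) * expectation (\<lambda>x. cos (\<xi> g x))\<bar> \<le> \<bar>f \<bullet> g\<bar>"
proof -
  let ?s = "- ((norm f)\<^sup>2 + (norm g)\<^sup>2) / 2"
  have m: "- (norm (f - g))\<^sup>2 / 2 = ?s + f \<bullet> g" and p: "- (norm (f + g))\<^sup>2 / 2 = ?s - f \<bullet> g"
    by (simp_all add: power2_norm_eq_inner inner_simps inner_commute field_simps)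
  have neg: "?s + f \<bullet> g \<le> 0" "?s - f \<bullet> g \<le> 0" "?s \<le> 0"
    using m p zero_le_power2[of "norm (f - g)"] zero_le_power2[of "norm (f + g)"]
    by linarith+
  have bds: "\<bar>exp (?s + f \<bullet> g) - exp ?s\<bar> \<le> \<bar>f \<bullet> g\<bar>" "\<bar>exp (?s - f \<bullet> g) - exp ?s\<bar> \<le> \<bar>f \<bullet> g\<bar>"
    using abs_exp_diff_le[OF neg(1,3)] abs_exp_diff_le[OF neg(2,3)]
    by (simp_all only: add_diff_cancel_left' diff_diff_eq2 diff_diff_add minus_diff_eq abs_minus_cancel abs_minus_commute)
  have prod: "exp (- (norm f)\<^sup>2 / 2) * exp (- (norm g)\<^sup>2 / 2) = exp ?s"
    by (simp add: field_simps flip: exp_add)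
  have *: "\<bar>(a + b) / 2 - c\<bar> \<le> K" if "\<bar>a - c\<bar> \<le> K" "\<bar>b - c\<bar> \<le> K" for a b c K :: real
    using that by (simp only: add_divide_distrib)
  show ?thesis
    unfolding expectation_cos_cos[OF assms] expectation_cos[OF assms(1)] expectation_cos[OF assms(2)] m p prod
    by (rule *[OF bds])
qed

lemma cov_sin_le:
  assumes "f \<in> E" "g \<in> E"
  shows "\<bar>expectation (\<lambda>x. sin (\<xi> f x) * sin (\<xi> g x))\<bar> \<le> \<bar>f \<bullet> g\<bar>"
proof -
  have "\<bar>exp (- (norm (f - g))\<^sup>2 / 2) - exp (- (norm (f + g))\<^sup>2 / 2)\<bar> \<le>
      \<bar>- (norm (f - g))\<^sup>2 / 2 - - (norm (f + g))\<^sup>2 / 2\<bar>"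
    by (intro abs_exp_diff_le) auto
  also have "\<dots> = \<bar>2 * (f \<bullet> g)\<bar>"
    by (simp add: power2_norm_eq_inner inner_simps inner_commute field_simps)
  finally show ?thesis unfolding expectation_sin_sin[OF assms] by simp
qed

text \<open>The expectation equals \<open>exp ?s * sinh (f \<bullet> g)\<close>. Here
  \<open>sinh x >= x\<close> for nonnegative \<open>x\<close>, and \<open>?s >= -1\<close> because
  both norms are at most 1.\<close>

lemma expectation_sin_sin_ge:
  assumes "f \<in> E" "g \<in> E" "norm f \<le> 1" "norm g \<le> 1" "0 \<le> f \<bullet> g"
  shows "f \<bullet> g / exp 1 \<le> expectation (\<lambda>x. sin (\<xi> f x) * sin (\<xi> g x))"
proof -
  let ?s = "- ((norm f)\<^sup>2 + (norm g)\<^sup>2) / 2"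
  have m: "- (norm (f - g))\<^sup>2 / 2 = ?s + f \<bullet> g" and p: "- (norm (f + g))\<^sup>2 / 2 = ?s - f \<bullet> g"
    by (simp_all add: power2_norm_eq_inner inner_simps inner_commute field_simps)
  have "(norm f)\<^sup>2 \<le> 1" "(norm g)\<^sup>2 \<le> 1" using assms by (simp_all add: abs_square_le_1)
  then have "exp (- 1) \<le> exp ?s" by simp
  moreover have "f \<bullet> g \<le> (exp (f \<bullet> g) - exp (- (f \<bullet> g))) / 2"
    using real_le_x_sinh[OF assms(5)] by (simp add: exp_minus)
  ultimately have "exp (- 1) * (f \<bullet> g) \<le> exp ?s * ((exp (f \<bullet> g) - exp (- (f \<bullet> g))) / 2)"
    using assms(5) by (intro mult_mono) auto
  also have "\<dots> = (exp (?s + f \<bullet> g) - exp (?s - f \<bullet> g)) / 2"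
    unfolding exp_add exp_diff by (simp add: exp_minus field_simps)
  finally show ?thesis
    unfolding expectation_sin_sin[OF assms(1,2)] m p by (simp add: exp_minus field_simps)
qed

text \<open>Each product of two sines is half a difference of cosines. The covariance is therefore a
  quarter of a signed sum of four cosine covariances, and bilinearity bounds each of them by all
  four mixed inner products. No higher Gaussian moments are computed.\<close>

lemma cov_sin_sin_le:
  assumes "f \<in> E" "g \<in> E" "h \<in> E" "k \<in> E"
  shows "\<bar>expectation (\<lambda>x. sin (\<xi> f x) * sin (\<xi> g x) * (sin (\<xi> h x) * sin (\<xi> k x))) -
      expectation (\<lambda>x. sin (\<xi> f x) * sin (\<xi> g x)) * expectation (\<lambda>x. sin (\<xi> h x) * sin (\<xi> k x))\<bar>
    \<le> \<bar>f \<bullet> h\<bar> + \<bar>f \<bullet> k\<bar> + \<bar>g \<bullet> h\<bar> + \<bar>g \<bullet> k\<bar>"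
proof -
  let ?c = "\<lambda>u x. cos (\<xi> u x)"
  have mem: "f - g \<in> E" "f + g \<in> E" "h - k \<in> E" "h + k \<in> E"
    using assms sum_diff_mem by auto
  have *: "a * b = (p * r - p * s - q * r + q * s) / 4"
    if "a = (p - q) / 2" "b = (r - s) / 2" for a b p q r s :: real
    unfolding that by (simp add: field_simps)
  have **: "\<bar>(a - b - c + d) / 4\<bar> \<le> K" if "\<bar>a\<bar> \<le> K" "\<bar>b\<bar> \<le> K" "\<bar>c\<bar> \<le> K" "\<bar>d\<bar> \<le> K" for a b c d K :: real
    using that by simp
  have i: "integrable P (\<lambda>x. ?c u x * ?c v x)" if "u \<in> E" "v \<in> E" for u v
    using that mult_mono[OF abs_cos_le_one abs_cos_le_one]
    by (intro integrable_bounded_rv[where c = 1]) (auto simp: abs_mult)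
  have "expectation (\<lambda>x. sin (\<xi> f x) * sin (\<xi> g x) * (sin (\<xi> h x) * sin (\<xi> k x))) =
     expectation (\<lambda>x. (?c (f-g) x * ?c (h-k) x - ?c (f-g) x * ?c (h+k) x
       - ?c (f+g) x * ?c (h-k) x + ?c (f+g) x * ?c (h+k) x) / 4)"
  proof (rule integral_cong_AE)
    show "AE x in P. sin (\<xi> f x) * sin (\<xi> g x) * (sin (\<xi> h x) * sin (\<xi> k x)) =
      (?c (f-g) x * ?c (h-k) x - ?c (f-g) x * ?c (h+k) x
       - ?c (f+g) x * ?c (h-k) x + ?c (f+g) x * ?c (h+k) x) / 4"
      using sin_times_sin_AE[OF assms(1,2)] sin_times_sin_AE[OF assms(3,4)]
      by eventually_elim (rule *)
  qed (use assms mem in auto)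
  also have "\<dots> = (expectation (\<lambda>x. ?c (f-g) x * ?c (h-k) x) - expectation (\<lambda>x. ?c (f-g) x * ?c (h+k) x)
       - expectation (\<lambda>x. ?c (f+g) x * ?c (h-k) x) + expectation (\<lambda>x. ?c (f+g) x * ?c (h+k) x)) / 4"
    using i mem by simp
  finally have 4: "expectation (\<lambda>x. sin (\<xi> f x) * sin (\<xi> g x) * (sin (\<xi> h x) * sin (\<xi> k x))) = \<dots>" .
  have 2: "expectation (\<lambda>x. sin (\<xi> u x) * sin (\<xi> v x)) =
      (expectation (?c (u - v)) - expectation (?c (u + v))) / 2" if "u \<in> E" "v \<in> E" for u v
    using that sum_diff_mem by (simp add: expectation_sin_sin expectation_cos)
  define cov where "cov u v = expectation (\<lambda>x. ?c u x * ?c v x) - expectation (?c u) * expectation (?c v)" for u v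
  have cov: "\<bar>cov u v\<bar> \<le> \<bar>u \<bullet> v\<bar>" if "u \<in> E" "v \<in> E" for u v
    unfolding cov_def using cov_cos_le[OF that] .
  have "expectation (\<lambda>x. sin (\<xi> f x) * sin (\<xi> g x) * (sin (\<xi> h x) * sin (\<xi> k x))) -
      expectation (\<lambda>x. sin (\<xi> f x) * sin (\<xi> g x)) * expectation (\<lambda>x. sin (\<xi> h x) * sin (\<xi> k x))
    = (cov (f-g) (h-k) - cov (f-g) (h+k) - cov (f+g) (h-k) + cov (f+g) (h+k)) / 4"
    unfolding 4 2[OF assms(1,2)] 2[OF assms(3,4)] cov_def by (simp add: field_simps)
  moreover have bd: "\<bar>cov u v\<bar> \<le> \<bar>f \<bullet> h\<bar> + \<bar>f \<bullet> k\<bar> + \<bar>g \<bullet> h\<bar> + \<bar>g \<bullet> k\<bar>"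
    if "u \<in> {f - g, f + g}" "v \<in> {h - k, h + k}" for u v
  proof (rule order_trans[OF cov])
    show "u \<in> E" "v \<in> E" using that mem by auto
    show "\<bar>u \<bullet> v\<bar> \<le> \<bar>f \<bullet> h\<bar> + \<bar>f \<bullet> k\<bar> + \<bar>g \<bullet> h\<bar> + \<bar>g \<bullet> k\<bar>"
    proof -
      have l: "\<bar>u \<bullet> v\<bar> \<le> \<bar>f \<bullet> v\<bar> + \<bar>g \<bullet> v\<bar>"
        using that(1) by (elim insertE emptyE) (simp_all only: inner_add_left inner_diff_left abs_triangle_ineq abs_triangle_ineq4)
      have r: "\<bar>w \<bullet> v\<bar> \<le> \<bar>w \<bullet> h\<bar> + \<bar>w \<bullet> k\<bar>" for w
        using that(2) by (elim insertE emptyE) (simp_all only: inner_add_right inner_diff_right abs_triangle_ineq abs_triangle_ineq4)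
      show ?thesis
        using order_trans[OF l add_mono[OF r r]] by (simp only: add.assoc)
    qed
  qed
  have "\<bar>(cov (f-g) (h-k) - cov (f-g) (h+k) - cov (f+g) (h-k) + cov (f+g) (h+k)) / 4\<bar>
      \<le> \<bar>f \<bullet> h\<bar> + \<bar>f \<bullet> k\<bar> + \<bar>g \<bullet> h\<bar> + \<bar>g \<bullet> k\<bar>"
    by (intro ** bd) simp_all
  ultimately show ?thesis by (simp only:)
qed

text \<open>The linear part has mean 0 because the field is centred, and the pairs contribute at
  least \<open>m * \<rho> / exp 1 = 2 * L\<close>. Thus \<open>L\<close> is half of a lower bound
  for the mean, and a value below \<open>L\<close> is a deviation of at least \<open>L\<close>. The
  variance is at most \<open>2 * R + 2 * R\<close>.\<close>

lemma pair_statistic_le: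
  fixes u :: "nat \<Rightarrow> 'g"
  assumes mem: "\<And>i. u i \<in> E" and norm: "\<And>i. norm (u i) \<le> 1"
    and nonneg: "\<And>i j. 0 \<le> u i \<bullet> u j"
    and R: "(\<Sum>i<2 * m. \<Sum>j<2 * m. u i \<bullet> u j) \<le> R"
    and \<rho>: "\<And>k. k < m \<Longrightarrow> \<rho> \<le> u (2 * k) \<bullet> u (2 * k + 1)"
    and eps: "\<And>i. \<bar>\<epsilon> i\<bar> \<le> 1"
    and L: "L = m * \<rho> / (2 * exp 1)" "0 < L"
  shows "prob {x \<in> space P. pair_statistic m \<epsilon> (\<lambda>i x. sin (\<xi> (u i) x)) x < L} \<le> 4 * R / L\<^sup>2"
proof -
  let ?\<theta> = "\<lambda>i x. sin (\<xi> (u i) x)"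
  let ?W = "pair_statistic m \<epsilon> ?\<theta>"
  have [measurable]: "?\<theta> i \<in> borel_measurable P" for i
    using \<xi>_measurable[OF mem[of i]] by measurable
  have "variance ?W \<le> 2 * (\<Sum>k<m. \<Sum>l<m. u (2*k) \<bullet> u (2*l) + u (2*k) \<bullet> u (2*l+1) + u (2*k+1) \<bullet> u (2*l) + u (2*k+1) \<bullet> u (2*l+1))
      + 2 * (\<Sum>i<2*m. \<Sum>j<2*m. u i \<bullet> u j)"
  proof (intro order_trans[OF variance_pair_statistic(1)[OF _ abs_sin_le_one eps]] add_mono mult_left_mono sum_mono)
    fix k l
    show "expectation (\<lambda>x. ?\<theta> (2*k) x * ?\<theta> (2*k+1) x * (?\<theta> (2*l) x * ?\<theta> (2*l+1) x)) -
        expectation (\<lambda>x. ?\<theta> (2*k) x * ?\<theta> (2*k+1) x) * expectation (\<lambda>x. ?\<theta> (2*l) x * ?\<theta> (2*l+1) x)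
      \<le> u (2*k) \<bullet> u (2*l) + u (2*k) \<bullet> u (2*l+1) + u (2*k+1) \<bullet> u (2*l) + u (2*k+1) \<bullet> u (2*l+1)"
      using abs_le_D1[OF cov_sin_sin_le[OF mem[of "2*k"] mem[of "2*k+1"] mem[of "2*l"] mem[of "2*l+1"]]]
      unfolding abs_of_nonneg[OF nonneg] .
  next
    fix i j
    have "expectation (\<lambda>x. \<epsilon> i * ?\<theta> i x * (\<epsilon> j * ?\<theta> j x)) = (\<epsilon> i * \<epsilon> j) * expectation (\<lambda>x. ?\<theta> i x * ?\<theta> j x)"
      by (subst integral_mult_right_zero[symmetric]) (simp add: mult_ac)
    also have "\<dots> \<le> \<bar>\<epsilon> i * \<epsilon> j\<bar> * \<bar>expectation (\<lambda>x. ?\<theta> i x * ?\<theta> j x)\<bar>"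
      by (metis abs_ge_self abs_mult)
    also have "\<dots> \<le> 1 * \<bar>u i \<bullet> u j\<bar>"
      using mult_mono[OF eps[of i] eps[of j] zero_le_one abs_ge_zero] cov_sin_le[OF mem[of i] mem[of j]]
      by (intro mult_mono) (auto simp: abs_mult)
    finally show "expectation (\<lambda>x. \<epsilon> i * ?\<theta> i x * (\<epsilon> j * ?\<theta> j x)) -
        expectation (\<lambda>x. \<epsilon> i * ?\<theta> i x) * expectation (\<lambda>x. \<epsilon> j * ?\<theta> j x) \<le> u i \<bullet> u j"
      using nonneg[of i j] by (simp add: expectation_sin mem)
  qed auto
  \<comment> \<open>The four terms for \<open>(k, l)\<close> fill the 2 by 2 cell at
    \<open>(2 * k, 2 * l)\<close>, and these cells tile the whole index square.\<close>
  also have "(\<Sum>k<m. \<Sum>l<m. u (2*k) \<bullet> u (2*l) + u (2*k) \<bullet> u (2*l+1) + u (2*k+1) \<bullet> u (2*l) + u (2*k+1) \<bullet> u (2*l+1))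
      = (\<Sum>i<2*m. \<Sum>j<2*m. u i \<bullet> u j)"
    by (simp only: sum_lessThan_double sum.distrib add_ac)
  finally have var: "variance ?W \<le> 4 * R" using R by linarith
  have "2 * L = (\<Sum>k<m. \<rho> / exp 1)" by (simp add: L)
  also have "\<dots> \<le> (\<Sum>k<m. expectation (\<lambda>x. ?\<theta> (2 * k) x * ?\<theta> (2 * k + 1) x))"
    by (intro sum_mono order_trans[OF _ expectation_sin_sin_ge] divide_right_mono \<rho> mem norm nonneg) auto
  also have "\<dots> = expectation ?W"
    by (subst variance_pair_statistic(2)[OF _ _ eps]) (auto simp: expectation_sin mem)
  finally have mean: "2 * L \<le> expectation ?W" .
  have "prob {x \<in> space P. ?W x < L} \<le> prob {x \<in> space P. L \<le> \<bar>?W x - expectation ?W\<bar>}"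
    using mean by (intro finite_measure_mono) auto
  also have "\<dots> \<le> variance ?W / L\<^sup>2"
    using L(2) variance_pair_statistic(3)[of m ?\<theta> \<epsilon>] eps
    by (intro Chebyshev_inequality) auto
  also have "\<dots> \<le> 4 * R / L\<^sup>2" using var L(2) by (intro divide_right_mono) auto
  finally show ?thesis .
qed

end

section \<open>Independence under the measure of a unit\<close>

lemma measure_type_refl: "prob_space M \<Longrightarrow> M \<in> measure_type M"
  by (simp add: measure_type_def absolutely_continuous_def)

lemma AE_measure_type:
  assumes "P \<in> measure_type M"
  shows "(AE x in P. Q x) \<longleftrightarrow> (AE x in M. Q x)"
proof -
  have "null_sets P = null_sets M"
    using assms by (auto simp: measure_type_def absolutely_continuous_def)
  moreover have "space P = space M"
    using assms by (auto simp: measure_type_def dest: sets_eq_imp_space_eq)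
  ultimately show ?thesis by (simp add: eventually_ae_filter)
qed

text \<open>A tensor product evaluates its factors at restrictions of one measure \<open>P\<close>;
  this shows that those restrictions belong to the types over which the factors are defined.\<close>

lemma restr_to_subalg_measure_type:
  assumes P: "P \<in> measure_type (restr_to_subalg M F)"
    and F: "subalgebra M F" and F1: "subalgebra F F1"
  shows "restr_to_subalg P F1 \<in> measure_type (restr_to_subalg M F1)"
proof -
  have MF1: "subalgebra M F1" using F F1 by (auto simp: subalgebra_def)
  have P': "prob_space P" "sets P = sets F" "null_sets P = null_sets (restr_to_subalg M F)"
    using P by (auto simp: measure_type_def absolutely_continuous_def sets_restr_to_subalg[OF F])
  have sub: "subalgebra P F1"
    using F1 P'(2) sets_eq_imp_space_eq[OF P'(2)] by (simp add: subalgebra_def)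
  have "null_sets (restr_to_subalg P F1) = null_sets (restr_to_subalg M F1)"
    using F1 by (auto simp: null_sets_restr_to_subalg[OF sub] null_sets_restr_to_subalg[OF MF1]
        null_sets_restr_to_subalg[OF F] P' subalgebra_def)
  then show ?thesis
    using prob_space_restr_to_subalg[OF sub P'(1)]
    by (simp add: measure_type_def absolutely_continuous_def sets_restr_to_subalg[OF sub] sets_restr_to_subalg[OF MF1])
qed

lemma RN_deriv_measure_type:
  assumes "Q \<in> measure_type M" "P \<in> measure_type M"
  shows "density Q (RN_deriv Q P) = P" "AE x in Q. RN_deriv Q P x \<noteq> \<infinity>"
proof -
  interpret Q: prob_space Q using assms by (simp add: measure_type_def)
  interpret P: prob_space P using assms by (simp add: measure_type_def)
  have ac: "absolutely_continuous Q P" and s: "sets P = sets Q"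
    using assms by (auto simp: measure_type_def absolutely_continuous_def)
  show "density Q (RN_deriv Q P) = P" by (rule Q.density_RN_deriv[OF ac s])
  show "AE x in Q. RN_deriv Q P x \<noteq> \<infinity>"
    by (rule Q.RN_deriv_finite[OF P.sigma_finite_measure ac s])
qed

section \<open>The measure given by the squared modulus of a vector\<close>

definition sq_measure :: "'w measure \<Rightarrow> 'w sqrt_vec \<Rightarrow> 'w measure" where
  "sq_measure Q \<psi> = density Q (\<lambda>x. ennreal ((cmod (\<psi> Q x))\<^sup>2))"

lemma sets_sq_measure [simp, measurable_cong]: "sets (sq_measure Q \<psi>) = sets Q"
  and space_sq_measure [simp]: "space (sq_measure Q \<psi>) = space Q"
  by (simp_all add: sq_measure_def)

text \<open>Since \<open>\<psi> Q\<close> is \<open>\<psi> P\<close> times the square root of the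
  density of \<open>P\<close> with respect to \<open>Q\<close>, the density appearing in the squared
  modulus cancels the change of the integrating measure. Hence every measure of the type yields the
  same squared-modulus measure.\<close>

lemma sq_measure_change:
  assumes Q: "prob_space Q" and P: "P \<in> measure_type Q" and \<psi>: "\<psi> \<in> L2_vecs Q" and A: "A \<in> sets Q"
  shows "(\<integral>\<^sup>+x. ennreal ((cmod (\<psi> P x))\<^sup>2) * indicator A x \<partial>P) = emeasure (sq_measure Q \<psi>) A"
proof -
  note QQ = measure_type_refl[OF Q]
  have sP: "sets P = sets Q" using P by (simp add: measure_type_def)
  have [measurable]: "\<psi> P \<in> borel_measurable Q" "\<psi> Q \<in> borel_measurable Q"
    using \<psi> P QQ measurable_cong_sets[OF sP refl] by (auto simp: L2_vecs_def)
  have [measurable]: "A \<in> sets Q" by fact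
  note RN = RN_deriv_measure_type[OF QQ P]
  have ae: "AE x in Q. \<psi> Q x = complex_of_real (sqrt_density P Q x) * \<psi> P x"
    using \<psi> P QQ by (auto simp: L2_vecs_def)
  have "(\<integral>\<^sup>+x. ennreal ((cmod (\<psi> P x))\<^sup>2) * indicator A x \<partial>P) =
     (\<integral>\<^sup>+x. ennreal ((cmod (\<psi> P x))\<^sup>2) * indicator A x \<partial>density Q (RN_deriv Q P))"
    by (simp add: RN)
  also have "\<dots> = (\<integral>\<^sup>+x. RN_deriv Q P x * (ennreal ((cmod (\<psi> P x))\<^sup>2) * indicator A x) \<partial>Q)"
    by (intro nn_integral_density) auto
  also have "\<dots> = (\<integral>\<^sup>+x. ennreal ((cmod (\<psi> Q x))\<^sup>2) * indicator A x \<partial>Q)"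
  proof (rule nn_integral_cong_AE)
    show "AE x in Q. RN_deriv Q P x * (ennreal ((cmod (\<psi> P x))\<^sup>2) * indicator A x) =
        ennreal ((cmod (\<psi> Q x))\<^sup>2) * indicator A x"
      using ae RN(2)
    proof eventually_elim
      case (elim x)
      \<comment> \<open>\<open>sqrt_density\<close> passes through \<open>enn2real\<close>, which
        sends infinity to 0; the almost sure finiteness of the density excludes that case.\<close>
      obtain r where r: "0 \<le> r" "RN_deriv Q P x = ennreal r"
        using elim(2) by (cases "RN_deriv Q P x") auto
      then have "(cmod (\<psi> Q x))\<^sup>2 = r * (cmod (\<psi> P x))\<^sup>2"
        by (simp add: elim(1) norm_mult power_mult_distrib sqrt_density_def)
      then show ?case
        using r by (simp add: ennreal_mult mult.assoc)
    qed
  qed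
  also have "\<dots> = emeasure (sq_measure Q \<psi>) A"
    unfolding sq_measure_def by (subst emeasure_density) auto
  finally show ?thesis .
qed

lemma absolutely_continuous_sq_measure: 
  assumes "prob_space Q" "\<psi> \<in> L2_vecs Q"
  shows "absolutely_continuous Q (sq_measure Q \<psi>)"
proof -
  have [measurable]: "\<psi> Q \<in> borel_measurable Q"
    using assms measure_type_refl by (auto simp: L2_vecs_def)
  show ?thesis unfolding sq_measure_def by (intro absolutely_continuousI_density) auto
qed

lemma emeasure_sq_measure_space:
  assumes Q: "prob_space Q" and \<psi>: "\<psi> \<in> L2_vecs Q" and nz: "\<not> vec_eq Q \<psi> (\<lambda>P x. 0)"
  shows "emeasure (sq_measure Q \<psi>) (space Q) \<noteq> 0" "emeasure (sq_measure Q \<psi>) (space Q) \<noteq> \<infinity>"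
proof -
  note QQ = measure_type_refl[OF Q]
  have [measurable]: "\<psi> Q \<in> borel_measurable Q" and int: "integrable Q (\<lambda>x. (cmod (\<psi> Q x))\<^sup>2)"
    using \<psi> QQ by (auto simp: L2_vecs_def)
  have eq: "emeasure (sq_measure Q \<psi>) (space Q) = (\<integral>\<^sup>+x. ennreal ((cmod (\<psi> Q x))\<^sup>2) \<partial>Q)"
    unfolding sq_measure_def by (subst emeasure_density) (auto intro!: nn_integral_cong)
  show "emeasure (sq_measure Q \<psi>) (space Q) \<noteq> \<infinity>"
    unfolding eq using int by (subst nn_integral_eq_integral) auto
  show "emeasure (sq_measure Q \<psi>) (space Q) \<noteq> 0"
  proof
    assume "emeasure (sq_measure Q \<psi>) (space Q) = 0"
    then have z: "AE x in Q. \<psi> Q x = 0"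
      unfolding eq by (subst (asm) nn_integral_0_iff_AE) auto
    \<comment> \<open>\<open>vec_eq\<close> quantifies over all measures of the type, so vanishing
      at the reference measure has to be carried to each of the others.\<close>
    have "AE x in P. \<psi> P x = 0" if P: "P \<in> measure_type Q" for P
    proof -
      have "AE x in P. \<psi> P x = complex_of_real (sqrt_density Q P x) * \<psi> Q x"
        using \<psi> P QQ by (auto simp: L2_vecs_def)
      moreover have "AE x in P. \<psi> Q x = 0" using z AE_measure_type[OF P] by simp
      ultimately show ?thesis by eventually_elim simp
    qed
    then show False using nz by (simp add: vec_eq_def)
  qed
qed

text \<open>For a measure \<open>P\<close> that makes the two fields independent, the squared
  modulus of \<open>\<psi> P\<close>, cut off to \<open>A \<inter> C\<close>, is a product of two
  independent functions, one for each field, and its integral factorizes. By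
  \<open>sq_measure_change\<close> the auxiliary \<open>P\<close> disappears from the
  result.\<close>

lemma is_tensor_sq_measure:
  fixes M :: "'w measure"
  assumes M: "prob_space M" and F: "subalgebra M F" and F1: "subalgebra F F1" and F2: "subalgebra F F2"
    and \<psi>: "\<psi> \<in> L2_vecs (restr_to_subalg M F)"
    and \<psi>1: "\<psi>1 \<in> L2_vecs (restr_to_subalg M F1)"
    and \<psi>2: "\<psi>2 \<in> L2_vecs (restr_to_subalg M F2)"
    and tensor: "is_tensor (restr_to_subalg M F) F1 F2 \<psi>1 \<psi>2 \<psi>"
    and A: "A \<in> sets F1" and C: "C \<in> sets F2"
  shows "emeasure (sq_measure (restr_to_subalg M F) \<psi>) (A \<inter> C) =
    emeasure (sq_measure (restr_to_subalg M F1) \<psi>1) A * emeasure (sq_measure (restr_to_subalg M F2) \<psi>2) C"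
proof -
  let ?Q = "restr_to_subalg M F"
  obtain P where P: "P \<in> measure_type ?Q" and ind: "prob_space.indep_set P (sets F1) (sets F2)"
    and eq: "vec_eq ?Q \<psi> (times_sqrt (\<lambda>x. \<psi>1 (restr_to_subalg P F1) x * \<psi>2 (restr_to_subalg P F2) x) P)"
    using tensor by (auto simp: is_tensor_def)
  interpret P: prob_space P using P by (simp add: measure_type_def)
  have MF1: "subalgebra M F1" and MF2: "subalgebra M F2"
    using F F1 F2 by (auto simp: subalgebra_def)
  have sP: "sets P = sets F" using P by (simp add: measure_type_def sets_restr_to_subalg[OF F])
  have PF1: "subalgebra P F1" and PF2: "subalgebra P F2"
    using F1 F2 sP sets_eq_imp_space_eq[OF sP] by (auto simp: subalgebra_def)
  let ?f1 = "\<psi>1 (restr_to_subalg P F1)" and ?f2 = "\<psi>2 (restr_to_subalg P F2)"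
  note mt1 = restr_to_subalg_measure_type[OF P F F1] and mt2 = restr_to_subalg_measure_type[OF P F F2]
  have f1: "?f1 \<in> borel_measurable F1"
    using \<psi>1 mt1 measurable_cong_sets[OF sets_restr_to_subalg[OF PF1] refl] by (auto simp: L2_vecs_def)
  have f2: "?f2 \<in> borel_measurable F2"
    using \<psi>2 mt2 measurable_cong_sets[OF sets_restr_to_subalg[OF PF2] refl] by (auto simp: L2_vecs_def)
  define g1 where "g1 x = ennreal ((cmod (?f1 x))\<^sup>2) * indicator A x" for x
  define g2 where "g2 x = ennreal ((cmod (?f2 x))\<^sup>2) * indicator C x" for x
  have g1[measurable]: "g1 \<in> borel_measurable F1" and g2[measurable]: "g2 \<in> borel_measurable F2"
    unfolding g1_def g2_def using f1 f2 A C by measurable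
  have cb: "case_bool borel borel = (\<lambda>_. borel)" by (auto split: bool.split)
  have AF: "A \<in> sets F" "C \<in> sets F" using A C F1 F2 by (auto simp: subalgebra_def)
  have indep: "P.indep_var borel g1 borel g2"
  proof -
    have sub: "sigma_sets (space P) {g -` S \<inter> space P |S. S \<in> sets borel} \<subseteq> sets F'"
      if "g \<in> borel_measurable F'" "subalgebra P F'" for g :: "'w \<Rightarrow> ennreal" and F'
    proof -
      have sp: "space P = space F'" using that(2) by (simp add: subalgebra_def)
      show ?thesis unfolding sp using that(1) by (intro sets.sigma_sets_subset) (auto simp: measurable_sets)
    qed
    have "P.indep_set (sigma_sets (space P) {g1 -` S \<inter> space P |S. S \<in> sets borel})
        (sigma_sets (space P) {g2 -` S \<inter> space P |S. S \<in> sets borel})"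
      using ind sub[OF g1 PF1] sub[OF g2 PF2] unfolding P.indep_sets2_eq by blast
    then show ?thesis
      unfolding P.indep_var_eq using measurable_from_subalg[OF PF1 g1] measurable_from_subalg[OF PF2 g2] by auto
  qed
  \<comment> \<open>Evaluating the tensor product at \<open>P\<close> itself leaves the factor
    \<open>sqrt_density P P\<close>, which is 1 almost surely by uniqueness of densities.\<close>
  have ae: "AE x in P. \<psi> P x = ?f1 x * ?f2 x"
  proof -
    have "AE x in P. \<psi> P x = complex_of_real (sqrt_density P P x) * (?f1 x * ?f2 x)"
      using eq P by (auto simp: vec_eq_def times_sqrt_def)
    moreover have "AE x in P. 1 = RN_deriv P P x"
      by (intro P.RN_deriv_unique) (auto simp: density_1)
    ultimately show ?thesis by eventually_elim (simp add: sqrt_density_def flip: one_ennreal_def)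
  qed
  have "emeasure (sq_measure ?Q \<psi>) (A \<inter> C) =
      (\<integral>\<^sup>+x. ennreal ((cmod (\<psi> P x))\<^sup>2) * indicator (A \<inter> C) x \<partial>P)"
    using AF by (intro sq_measure_change[symmetric] prob_space_restr_to_subalg F M P \<psi>)
      (auto simp: sets_restr_to_subalg[OF F])
  also have "\<dots> = (\<integral>\<^sup>+x. g1 x * g2 x \<partial>P)"
    using ae by (intro nn_integral_cong_AE, eventually_elim)
      (auto simp: g1_def g2_def norm_mult power_mult_distrib ennreal_mult split: split_indicator)
  also have "\<dots> = (\<integral>\<^sup>+x. g1 x \<partial>P) * (\<integral>\<^sup>+x. g2 x \<partial>P)"
    using P.indep_vars_nn_integral[OF finite_class.finite_UNIV indep[unfolded P.indep_var_def cb]]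
    by (simp add: UNIV_bool mult.commute)
  also have "(\<integral>\<^sup>+x. g1 x \<partial>P) = (\<integral>\<^sup>+x. g1 x \<partial>restr_to_subalg P F1)"
    by (intro nn_integral_subalgebra2[symmetric] PF1 g1)
  also have "\<dots> = emeasure (sq_measure (restr_to_subalg M F1) \<psi>1) A"
    unfolding g1_def using A
    by (intro sq_measure_change prob_space_restr_to_subalg MF1 M mt1 \<psi>1) (auto simp: sets_restr_to_subalg[OF MF1])
  also have "(\<integral>\<^sup>+x. g2 x \<partial>P) = (\<integral>\<^sup>+x. g2 x \<partial>restr_to_subalg P F2)"
    by (intro nn_integral_subalgebra2[symmetric] PF2 g2)
  also have "\<dots> = emeasure (sq_measure (restr_to_subalg M F2) \<psi>2) C"
    unfolding g2_def using C
    by (intro sq_measure_change prob_space_restr_to_subalg MF2 M mt2 \<psi>2) (auto simp: sets_restr_to_subalg[OF MF2])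
  finally show ?thesis .
qed

section \<open>Sigma-fields of intervals and independence along a chain of intervals\<close>

lemma gen_field_subset_Pow:
  "{\<xi> f -` S \<inter> space M | f S. f \<in> E \<and> S \<in> sets borel} \<union> null_sets M \<subseteq> Pow (space M)"
  by (auto dest: sets.sets_into_space)

lemma space_gen_field [simp]: "space (gen_field M \<xi> E) = space M"
  unfolding gen_field_def by (rule space_measure_of[OF gen_field_subset_Pow])

lemma sets_gen_field:
  "sets (gen_field M \<xi> E) =
    sigma_sets (space M) ({\<xi> f -` S \<inter> space M | f S. f \<in> E \<and> S \<in> sets borel} \<union> null_sets M)"
  unfolding gen_field_def by (rule sets_measure_of[OF gen_field_subset_Pow])

lemma subalgebra_gen_field:
  assumes "\<And>f. f \<in> E \<Longrightarrow> \<xi> f \<in> borel_measurable M"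
  shows "subalgebra M (gen_field M \<xi> E)"
  using assms unfolding subalgebra_def sets_gen_field
  by (auto intro!: sets.sigma_sets_subset intro: measurable_sets)

lemma subalgebra_gen_field_mono:
  assumes "E \<subseteq> E'"
  shows "subalgebra (gen_field M \<xi> E') (gen_field M \<xi> E)"
  using assms unfolding subalgebra_def sets_gen_field
  by (intro conjI sigma_sets_mono' Un_mono) (simp, blast, simp)

lemma measurable_gen_field: "f \<in> E \<Longrightarrow> \<xi> f \<in> borel_measurable (gen_field M \<xi> E)"
  by (intro measurableI) (auto simp: sets_gen_field)

lemma L2_interval_mono: "a' \<le> a \<Longrightarrow> b \<le> b' \<Longrightarrow> L2_interval a b \<subseteq> L2_interval a' b'"
  by (force simp: L2_interval_def)

lemma G_space_mono: "a' \<le> a \<Longrightarrow> b \<le> b' \<Longrightarrow> G_space J a b \<subseteq> G_space J a' b'"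
  unfolding G_space_def by (intro closure_mono image_mono L2_interval_mono)

text \<open>Induction on \<open>k\<close>, cutting off the last interval: by \<open>mono\<close> the
  intersection of the earlier events lies in the field of the interval that they span, so
  \<open>split\<close> applies at the last cut.\<close>

lemma measure_INT_chain:
  fixes N F :: "'i::order \<Rightarrow> 'i \<Rightarrow> 'w measure" and t :: "nat \<Rightarrow> 'i"
  assumes t: "strict_mono t"
    and mono: "\<And>a b c d. a \<le> b \<Longrightarrow> b < c \<Longrightarrow> c \<le> d \<Longrightarrow> sets (F b c) \<subseteq> sets (F a d)"
    and split: "\<And>a b c A C. a < b \<Longrightarrow> b < c \<Longrightarrow> A \<in> sets (F a b) \<Longrightarrow> C \<in> sets (F b c) \<Longrightarrow>
        measure (N a c) (A \<inter> C) = measure (N a b) A * measure (N b c) C"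
    and A: "\<And>i. i \<le> k \<Longrightarrow> A i \<in> sets (F (t i) (t (Suc i)))"
  shows "measure (N (t 0) (t (Suc k))) (\<Inter>i\<le>k. A i) = (\<Prod>i\<le>k. measure (N (t i) (t (Suc i))) (A i))"
  using A
proof (induction k)
  case 0
  then show ?case by simp
next
  case (Suc k)
  have "A i \<in> sets (F (t 0) (t (Suc k)))" if "i \<le> k" for i
    using Suc.prems[of i] that mono[of "t 0" "t i" "t (Suc i)" "t (Suc k)"] t
    by (auto simp: strict_mono_less_eq strict_mono_less)
  then have "(\<Inter>i\<le>k. A i) \<in> sets (F (t 0) (t (Suc k)))"
    by (intro sets.finite_INT) auto
  then have "measure (N (t 0) (t (Suc (Suc k)))) ((\<Inter>i\<le>k. A i) \<inter> A (Suc k)) =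
      measure (N (t 0) (t (Suc k))) (\<Inter>i\<le>k. A i) * measure (N (t (Suc k)) (t (Suc (Suc k)))) (A (Suc k))"
    using Suc.prems t by (intro split) (auto simp: strict_mono_less)
  then show ?case
    using Suc by (simp add: atMost_Suc Int_commute mult.commute)
qed

text \<open>The measures \<open>N a b\<close> need not have mass 1, so the product formula has to be
  normalized. Taking every event equal to \<open>\<Omega>\<close> relates \<open>c\<close> to the
  masses \<open>z i\<close>; taking all but the \<open>j\<close>-th equal to \<open>\<Omega>\<close>
  identifies the marginal as \<open>x j B / z j\<close>.\<close>

lemma indep_sets_chain:
  fixes N F :: "'i::order \<Rightarrow> 'i \<Rightarrow> 'w measure" and t :: "nat \<Rightarrow> 'i"
  assumes t: "strict_mono t"
    and mono: "\<And>a b c d. a \<le> b \<Longrightarrow> b < c \<Longrightarrow> c \<le> d \<Longrightarrow> sets (F b c) \<subseteq> sets (F a d)"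
    and split: "\<And>a b c A C. a < b \<Longrightarrow> b < c \<Longrightarrow> A \<in> sets (F a b) \<Longrightarrow> C \<in> sets (F b c) \<Longrightarrow>
        measure (N a c) (A \<inter> C) = measure (N a b) A * measure (N b c) C"
    and space: "\<And>a b. a < b \<Longrightarrow> space (F a b) = \<Omega>"
    and pos: "\<And>a b. a < b \<Longrightarrow> measure (N a b) \<Omega> > 0"
    and \<mu>: "prob_space \<mu>" "sets \<mu> = sets (F (t 0) (t n))" "\<And>A. measure \<mu> A = c * measure (N (t 0) (t n)) A"
    and n: "0 < n"
  shows "prob_space.indep_sets \<mu> (\<lambda>i. sets (F (t i) (t (Suc i)))) {..<n}"
proof -
  interpret prob_space \<mu> by fact
  obtain k where k: "n = Suc k" using n by (cases n) auto
  have lt: "t i < t (Suc i)" for i using t by (simp add: strict_mono_less)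
  have sp: "space \<mu> = \<Omega>"
    using sets_eq_imp_space_eq[OF \<mu>(2)] space[of "t 0" "t n"] t n by (simp add: strict_mono_less)
  have \<Omega>: "\<Omega> \<in> sets (F (t i) (t (Suc i)))" for i using space[OF lt, of i] by (metis sets.top)
  define z where "z i = measure (N (t i) (t (Suc i))) \<Omega>" for i
  define x where "x i = measure (N (t i) (t (Suc i)))" for i
  have z: "z i > 0" for i unfolding z_def by (rule pos[OF lt])
  have chain: "prob (\<Inter>i\<le>k. A i) = c * (\<Prod>i\<le>k. x i (A i))"
    if "\<And>i. i \<le> k \<Longrightarrow> A i \<in> sets (F (t i) (t (Suc i)))" for A
    unfolding \<mu>(3) k x_def by (subst measure_INT_chain[OF t mono split]) (use that in auto)
  have "prob (\<Inter>i\<le>k. \<Omega>) = c * (\<Prod>i\<le>k. z i)"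
    using chain[of "\<lambda>_. \<Omega>"] \<Omega> by (simp add: x_def z_def)
  then have c: "c * (\<Prod>i\<le>k. z i) = 1" using prob_space sp by simp
  have one: "prob B = x j B / z j" if B: "B \<in> sets (F (t j) (t (Suc j)))" and j: "j \<le> k" for B j
  proof -
    have "B \<subseteq> \<Omega>" using sets.sets_into_space[OF B] space[OF lt] by simp
    then have "(\<Inter>i\<le>k. if i = j then B else \<Omega>) = B" using j by (auto split: if_splits)
    then have "prob B = c * (\<Prod>i\<le>k. x i (if i = j then B else \<Omega>))"
      using chain[of "\<lambda>i. if i = j then B else \<Omega>"] \<Omega> B by simp
    also have "(\<Prod>i\<le>k. x i (if i = j then B else \<Omega>)) = x j B * (\<Prod>i\<in>{..k} - {j}. z i)"
      using j by (subst prod.remove[of _ j]) (auto simp: x_def z_def intro!: prod.cong)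
    also have "(\<Prod>i\<in>{..k} - {j}. z i) = (\<Prod>i\<le>k. z i) / z j"
      using j z[of j] by (simp add: prod.remove[of "{..k}" j])
    finally show ?thesis using c by simp
  qed
  have sub: "sets (F (t i) (t (Suc i))) \<subseteq> events" if "i \<le> k" for i
    unfolding \<mu>(2) k using that t by (intro mono) (auto simp: strict_mono_less_eq strict_mono_less)
  have "prob (\<Inter>i\<in>{..k}. A i) = (\<Prod>i\<in>{..k}. prob (A i))" if A: "A \<in> Pi {..k} (\<lambda>i. sets (F (t i) (t (Suc i))))" for A
  proof -
    have "c * (\<Prod>i\<le>k. x i (A i)) = (\<Prod>i\<le>k. x i (A i)) / (\<Prod>i\<le>k. z i)"
    proof -
      have "0 < (\<Prod>i\<le>k. z i)" using z by (intro prod_pos) auto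
      then have "c = 1 / (\<Prod>i\<le>k. z i)" using nonzero_eq_divide_eq[of "\<Prod>i\<le>k. z i" c 1] c by (metis less_irrefl)
      then show ?thesis by simp
    qed
    moreover have "prob (\<Inter>i\<in>{..k}. A i) = c * (\<Prod>i\<le>k. x i (A i))" using A by (intro chain) auto
    moreover have "(\<Prod>i\<in>{..k}. prob (A i)) = (\<Prod>i\<le>k. x i (A i) / z i)"
      using A by (intro prod.cong one) auto
    ultimately show ?thesis by (simp add: prod_dividef)
  qed
  \<comment> \<open>Every field contains the whole space, so the product rule for the full index set
    already implies it for all subsets.\<close>
  then show ?thesis
    unfolding k lessThan_Suc_atMost using sub \<Omega> sp
    by (subst indep_sets_finite) auto
qed

text \<open>The measure is the normalized squared modulus of \<open>\<psi> 0 1\<close>. It is the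
  same for all \<open>n\<close>, because every grid \<open>i / n\<close> with \<open>i <= n\<close>
  subdivides the same interval.\<close>

lemma system_unit_indep_measure:
  assumes sys: "product_system_of B J M \<xi>" and unit: "is_system_unit J M \<xi> \<psi>"
  obtains \<mu> where "prob_space \<mu>" "sets \<mu> = sets (G_measure J M \<xi> 0 1)"
    "absolutely_continuous (G_measure J M \<xi> 0 1) \<mu>"
    "\<And>n. 0 < n \<Longrightarrow> prob_space.indep_sets \<mu>
      (\<lambda>i. sets (G_field J M \<xi> (real i / real n) (real (Suc i) / real n))) {..<n}"
proof -
  let ?F = "G_field J M \<xi>" and ?Q = "G_measure J M \<xi>"
  have M: "prob_space M" and meas: "\<And>a b f. a < b \<Longrightarrow> f \<in> G_space J a b \<Longrightarrow> \<xi> f \<in> borel_measurable M"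
    using sys by (auto simp: product_system_of_def measure_type_space_def)
  have F: "subalgebra M (?F a b)" if "a < b" for a b
    unfolding G_field_def using meas[OF that] by (rule subalgebra_gen_field)
  have FF: "subalgebra (?F a d) (?F b c)" if "a \<le> b" "c \<le> d" for a b c d
    unfolding G_field_def by (intro subalgebra_gen_field_mono G_space_mono that)
  have Q: "prob_space (?Q a b)" if "a < b" for a b
    unfolding G_measure_def by (intro prob_space_restr_to_subalg F that M)
  have L2: "\<psi> a b \<in> L2_vecs (?Q a b)" and nz: "\<not> vec_eq (?Q a b) (\<psi> a b) (\<lambda>P x. 0)" if "a < b" for a b
    using unit that by (auto simp: is_system_unit_def H_space_def)
  define N where "N a b = sq_measure (?Q a b) (\<psi> a b)" for a b
  have sF: "sets (?Q a b) = sets (?F a b)" if "a < b" for a b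
    unfolding G_measure_def by (rule sets_restr_to_subalg[OF F[OF that]])
  have split: "measure (N a c) (A \<inter> C) = measure (N a b) A * measure (N b c) C"
    if "a < b" "b < c" "A \<in> sets (?F a b)" "C \<in> sets (?F b c)" for a b c A C
  proof -
    have ac: "a < c" using that by simp
    have "emeasure (N a c) (A \<inter> C) = emeasure (N a b) A * emeasure (N b c) C"
      unfolding N_def G_measure_def
    proof (rule is_tensor_sq_measure[OF M F[OF ac] FF FF])
      show "is_tensor (restr_to_subalg M (?F a c)) (?F a b) (?F b c) (\<psi> a b) (\<psi> b c) (\<psi> a c)"
        using unit that unfolding is_system_unit_def G_measure_def by blast
    qed (use that ac L2[of a c] L2[of a b] L2[of b c] in \<open>auto simp: G_measure_def\<close>)
    then show ?thesis by (simp add: measure_def enn2real_mult)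
  qed
  have pos: "emeasure (N a b) (space M) \<noteq> 0" "emeasure (N a b) (space M) \<noteq> \<infinity>" if "a < b" for a b
    using emeasure_sq_measure_space[OF Q L2 nz] that
    by (auto simp: N_def G_measure_def space_restr_to_subalg)
  define Z where "Z = measure (N 0 1) (space M)"
  have mpos: "measure (N a b) (space M) > 0" if "a < b" for a b
    using pos[OF that] by (simp add: measure_def enn2real_positive_iff less_top zero_less_iff_neq_zero)
  define \<mu> where "\<mu> = scale_measure (ennreal (1 / Z)) (N 0 1)"
  have Z: "Z > 0" "emeasure (N 0 1) (space M) = ennreal Z"
    using mpos[of 0 1] pos[of 0 1] by (auto simp: Z_def measure_def less_top)
  have spN: "space (N a b) = space M" for a b by (simp add: N_def G_measure_def space_restr_to_subalg)
  show thesis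
  proof
    show \<mu>: "prob_space \<mu>"
    proof
      have "emeasure \<mu> (space \<mu>) = ennreal (1 / Z) * ennreal Z"
        by (simp add: \<mu>_def space_scale_measure spN Z(2))
      also have "\<dots> = 1" using Z(1) by (simp flip: ennreal_mult'')
      finally show "emeasure \<mu> (space \<mu>) = 1" .
    qed
    show s\<mu>: "sets \<mu> = sets (?Q 0 1)" by (simp add: \<mu>_def N_def)
    show "absolutely_continuous (?Q 0 1) \<mu>"
      using absolutely_continuous_sq_measure[OF Q L2, of 0 1]
      by (auto simp: \<mu>_def N_def absolutely_continuous_def null_sets_def)
    fix n :: nat assume n: "0 < n"
    \<comment> \<open>The grid is continued beyond 1, since \<open>indep_sets_chain\<close> takes an
      infinite strictly increasing sequence; the conclusion concerns its first \<open>n\<close>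
      intervals.\<close>
    have "prob_space.indep_sets \<mu> (\<lambda>i. sets (?F ((\<lambda>i. real i / real n) i) ((\<lambda>i. real i / real n) (Suc i)))) {..<n}"
    proof (rule indep_sets_chain[where N = N and \<Omega> = "space M" and c = "1 / Z"])
      show "strict_mono (\<lambda>i. real i / real n)" using n by (auto intro!: strict_monoI divide_strict_right_mono)
      show "sets (?F b c) \<subseteq> sets (?F a d)" if "a \<le> b" "c \<le> d" for a b c d
        using FF[OF that] by (simp add: subalgebra_def)
      show "space (?F a b) = space M" for a b by (simp add: G_field_def)
      show "sets \<mu> = sets (?F (real 0 / real n) (real n / real n))" using s\<mu> sF[of 0 1] n by simp
      show "measure \<mu> A = 1 / Z * measure (N (real 0 / real n) (real n / real n)) A" for A
        using Z(1) n by (simp add: \<mu>_def measure_def enn2real_mult)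
    qed (use split mpos \<mu> n in auto)
    then show "prob_space.indep_sets \<mu> (\<lambda>i. sets (?F (real i / real n) (real (Suc i) / real n))) {..<n}"
      by simp
  qed
qed

section \<open>Separability and orthogonal bases\<close>

lemma subspace_closure:
  fixes S :: "'a::real_normed_vector set"
  assumes "subspace S"
  shows "subspace (closure S)"
  unfolding subspace_def
proof (intro conjI ballI allI)
  show "0 \<in> closure S" using subspace_0[OF assms] closure_subset by blast
  fix x y c assume "x \<in> closure S" "y \<in> closure S"
  then obtain f g where "\<And>n. f n \<in> S" "f \<longlonglongrightarrow> x" "\<And>n. g n \<in> S" "g \<longlonglongrightarrow> y"
    unfolding closure_sequential by blast
  then have "\<And>n. f n + g n \<in> S" "(\<lambda>n. f n + g n) \<longlonglongrightarrow> x + y"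
    and "\<And>n. c *\<^sub>R f n \<in> S" "(\<lambda>n. c *\<^sub>R f n) \<longlonglongrightarrow> c *\<^sub>R x"
    using assms by (auto intro: subspace_add subspace_scale tendsto_intros)
  note seq = this
  show "x + y \<in> closure S"
    unfolding closure_sequential using seq(1,2) by (intro exI[of _ "\<lambda>n. f n + g n"]) simp
  show "c *\<^sub>R x \<in> closure S"
    unfolding closure_sequential using seq(3,4) by (intro exI[of _ "\<lambda>n. c *\<^sub>R f n"]) simp
qed

lemma polar_norm [simp]: "polar norm x y = x \<bullet> (y :: 'a::real_inner)"
  by (simp add: polar_def power2_norm_eq_inner inner_simps inner_commute)

lemma Metric_space_norm_dist: "Metric_space H (norm_dist H (norm :: 'a::real_normed_vector \<Rightarrow> real))"
  by unfold_locales (auto simp: norm_dist_def norm_minus_commute dist_norm[symmetric] dist_triangle)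

text \<open>Bridge from the FHS notions, which are phrased with \<open>Metric_space\<close> on a
  carrier, to the topology of the type class.\<close>

lemma norm_topology_norm: "norm_topology H norm = top_of_set (H :: 'a::real_normed_vector set)"
proof -
  interpret Metric_space H "norm_dist H norm" by (rule Metric_space_norm_dist)
  have "openin mtopology U \<longleftrightarrow> openin (top_of_set H) U" for U
    unfolding openin_mtopology openin_euclidean_subtopology_iff
    by (auto simp: norm_dist_def subset_iff dist_norm norm_minus_commute mball_def cong: conj_cong) (metis subsetD)+
  then show ?thesis by (simp add: norm_topology_def topology_eq)
qed

lemma mcomplete_norm_dist:
  fixes H :: "'a::{real_normed_vector, complete_space} set"
  assumes "closed H"
  shows "Metric_space.mcomplete H (norm_dist H norm)"
proof -
  interpret Metric_space H "norm_dist H norm" by (rule Metric_space_norm_dist)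
  show ?thesis unfolding mcomplete_def
  proof (intro allI impI)
    fix \<sigma> assume \<sigma>: "MCauchy \<sigma>"
    then have r: "\<sigma> n \<in> H" for n by (auto simp: MCauchy_def)
    then have "Cauchy \<sigma>" using \<sigma> by (simp add: MCauchy_def Cauchy_def norm_dist_def dist_norm)
    then obtain l where l: "\<sigma> \<longlonglongrightarrow> l" using Cauchy_convergent convergent_def by blast
    then have "l \<in> H" using closed_sequentially[OF assms] r by blast
    then show "\<exists>x. limitin mtopology \<sigma> x sequentially"
      using l r unfolding limit_metric_sequentially by (auto simp: LIMSEQ_def norm_dist_def dist_norm)
  qed
qed

text \<open>Rational combinations of initial segments of \<open>v\<close> are dense. Indexing them
  by lists of rationals makes their countability immediate.\<close>

lemma separable_closure_span:
  fixes v :: "nat \<Rightarrow> 'a::real_normed_vector"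
  shows "separable_space (top_of_set (closure (span (range v))))"
proof -
  define D where "D = (\<lambda>l :: rat list. \<Sum>i<length l. real_of_rat (l ! i) *\<^sub>R v i) ` UNIV"
  have D: "D \<subseteq> span (range v)" unfolding D_def by (auto intro!: span_sum[where A = "{..<n}" for n] intro: span_scale span_base)
  have "span (range v) \<subseteq> closure D"
  proof
    fix x assume "x \<in> span (range v)"
    have "\<exists>n c. x = (\<Sum>i<n. c i *\<^sub>R v i)"
      using \<open>x \<in> span (range v)\<close>
    proof (induction rule: span_induct_alt)
      case base show ?case by (intro exI[of _ 0]) simp
    next
      case (step c y x)
      then obtain n d j where x: "x = (\<Sum>i<n. d i *\<^sub>R v i)" and j: "y = v j" by auto
      define m where "m = max n (Suc j)"
      have "(\<Sum>i<n. d i *\<^sub>R v i) = (\<Sum>i<m. (if i < n then d i else 0) *\<^sub>R v i)"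
        by (rule sum.mono_neutral_cong_left) (auto simp: m_def)
      moreover have "c *\<^sub>R v j = (\<Sum>i<m. (if i = j then c else 0) *\<^sub>R v i)"
        by (subst sum.remove[of _ j]) (auto simp: m_def intro!: sum.neutral)
      ultimately have "c *\<^sub>R y + x = (\<Sum>i<m. ((if i = j then c else 0) + (if i < n then d i else 0)) *\<^sub>R v i)"
        by (simp add: x j scaleR_add_left sum.distrib)
      then show ?case by (intro exI)
    qed
    then obtain n c where x: "x = (\<Sum>i<n. c i *\<^sub>R v i)" by blast
    have ex: "\<exists>r. \<bar>real_of_rat r - y\<bar> < inverse (Suc k)" for y k
      using of_rat_dense[of "y - inverse (Suc k)" "y + inverse (Suc k)"] by (auto simp: abs_less_iff algebra_simps)
    define q where "q i k = (SOME r. \<bar>real_of_rat r - c i\<bar> < inverse (Suc k))" for i k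
    have q: "\<bar>real_of_rat (q i k) - c i\<bar> < inverse (Suc k)" for i k
      unfolding q_def by (rule someI_ex[OF ex])
    have "(\<lambda>k. real_of_rat (q i k)) \<longlonglongrightarrow> c i" for i
      by (rule LIM_zero_cancel, rule Lim_null_comparison[OF _ LIMSEQ_inverse_real_of_nat])
        (use q in \<open>auto simp: less_imp_le\<close>)
    then have "(\<lambda>k. \<Sum>i<n. real_of_rat (q i k) *\<^sub>R v i) \<longlonglongrightarrow> x"
      unfolding x by (intro tendsto_intros)
    moreover have "(\<Sum>i<n. real_of_rat (q i k) *\<^sub>R v i) \<in> D" for k
      unfolding D_def by (intro image_eqI[where x = "map (\<lambda>i. q i k) [0..<n]"]) auto
    ultimately show "x \<in> closure D"
      unfolding closure_sequential by (intro exI[of _ "\<lambda>k. \<Sum>i<n. real_of_rat (q i k) *\<^sub>R v i"]) simp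
  qed
  then have "closure (span (range v)) \<subseteq> closure D"
    by (simp add: closure_minimal)
  moreover have sub: "D \<subseteq> closure (span (range v))" using D closure_subset by blast
  moreover have "countable D" unfolding D_def by auto
  moreover have "top_of_set (closure (span (range v))) closure_of D = closure (span (range v)) \<inter> closure D"
    using sub by (simp add: closure_of_subtopology Int_absorb1)
  ultimately show ?thesis
    unfolding separable_space_def by (intro exI[of _ D]) auto
qed

section \<open>Gram-Schmidt orthogonalization and admissibility of the given norm\<close>

fun gram_schmidt_seq :: "(nat \<Rightarrow> 'a::real_inner) \<Rightarrow> nat \<Rightarrow> 'a" where
  "gram_schmidt_seq v n = v n - (\<Sum>k<n. (v n \<bullet> gram_schmidt_seq v k / (norm (gram_schmidt_seq v k))\<^sup>2) *\<^sub>R gram_schmidt_seq v k)"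

declare gram_schmidt_seq.simps [simp del]

text \<open>The sequence \<open>v\<close> may be linearly dependent. A dependent vector then
  produces 0, which contributes nothing to later steps; the zeros are removed afterwards through the
  index set of the basis.\<close>

lemma gram_schmidt_orthogonal: "j < n \<Longrightarrow> gram_schmidt_seq v n \<bullet> gram_schmidt_seq v j = 0"
proof (induction n arbitrary: j rule: less_induct)
  case (less n)
  let ?e = "gram_schmidt_seq v"
  have "(\<Sum>k<n. (v n \<bullet> ?e k / (norm (?e k))\<^sup>2) * (?e k \<bullet> ?e j)) = (v n \<bullet> ?e j / (norm (?e j))\<^sup>2) * (?e j \<bullet> ?e j)"
  proof (subst sum.remove[of _ j])
    have "?e k \<bullet> ?e j = 0" if "k < n" "k \<noteq> j" for k
      using less.IH[of k j] less.IH[of j k] less.prems that by (cases "k < j") (auto simp: inner_commute)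
    then show "v n \<bullet> ?e j / (norm (?e j))\<^sup>2 * (?e j \<bullet> ?e j) +
        (\<Sum>k\<in>{..<n} - {j}. v n \<bullet> ?e k / (norm (?e k))\<^sup>2 * (?e k \<bullet> ?e j)) = v n \<bullet> ?e j / (norm (?e j))\<^sup>2 * (?e j \<bullet> ?e j)"
      by simp
  qed (use less.prems in auto)
  \<comment> \<open>If \<open>?e j = 0\<close>, both sides are 0; otherwise the squared norm
    cancels.\<close>
  also have "\<dots> = v n \<bullet> ?e j" by (simp add: power2_norm_eq_inner)
  finally show ?case
    by (subst gram_schmidt_seq.simps) (simp add: inner_diff_left inner_sum_left)
qed

lemma span_gram_schmidt:
  "span (gram_schmidt_seq v ` {n. gram_schmidt_seq v n \<noteq> 0}) = span (range v)"
proof -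
  let ?e = "gram_schmidt_seq v"
  let ?S = "?e ` {n. ?e n \<noteq> 0}"
  have e: "?e n \<in> span ?S" for n
    by (cases "?e n = 0") (auto intro: span_zero span_base)
  have "v n \<in> span ?S" for n
  proof -
    have "v n = ?e n + (\<Sum>k<n. (v n \<bullet> ?e k / (norm (?e k))\<^sup>2) *\<^sub>R ?e k)"
      by (subst gram_schmidt_seq.simps) simp
    also have "\<dots> \<in> span ?S" by (intro span_add span_sum span_scale e)
    finally show ?thesis .
  qed
  moreover have "?e n \<in> span (range v)" for n
  proof (induction n rule: less_induct)
    case (less n)
    show ?case by (subst gram_schmidt_seq.simps) (intro span_diff span_sum span_scale span_base less, auto)
  qed
  ultimately show ?thesis by (intro span_eq[THEN iffD2]) auto
qed

text \<open>A Gaussian measure is provided only for admissible norms. That the original norm is one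
  of them amounts to reflexivity, which still demands completeness, separability and an orthogonal
  basis.\<close>

lemma FHS_equivalent_norm:
  fixes v :: "nat \<Rightarrow> 'g::{real_inner, complete_space}"
  defines "H \<equiv> closure (span (range v))"
  shows "FHS_equivalent H norm norm"
proof -
  let ?e = "gram_schmidt_seq v"
  let ?I = "{n. ?e n \<noteq> 0}"
  have sub: "subspace H" unfolding H_def by (intro subspace_closure) simp
  have hil: "separable_hilbert_norm H norm"
    unfolding separable_hilbert_norm_def norm_topology_norm
    using sub mcomplete_norm_dist[of H] separable_closure_span[of v]
    by (auto simp: H_def inner_commute inner_simps norm_eq_sqrt_inner)
  have sp: "span (?e ` ?I) \<subseteq> H" by (simp add: span_gram_schmidt H_def closure_subset)
  have "orthogonal_basis H norm ?I ?e"
    unfolding orthogonal_basis_def norm_topology_norm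
  proof (intro conjI ballI impI)
    show "?e k \<in> H" if "k \<in> ?I" for k using sp that by (auto intro: span_base)
    show "polar norm (?e j) (?e k) = 0" if "j \<noteq> k" for j k
      using that gram_schmidt_orthogonal[of j k v] gram_schmidt_orthogonal[of k j v]
      by (cases "j < k") (auto simp: inner_commute)
    show "top_of_set H closure_of span (?e ` ?I) = H"
      using sp by (simp add: closure_of_subtopology Int_absorb1 span_gram_schmidt) (simp add: H_def)
  qed auto
  moreover have "(\<lambda>k. (norm (?e k) / norm (?e k) - 1)\<^sup>2) summable_on ?I"
    by (rule summable_on_cong[THEN iffD2, of _ _ "\<lambda>_. 0"]) auto
  ultimately show ?thesis using hil unfolding FHS_equivalent_def by blast
qed

section \<open>The spaces of a covariance kernel\<close>

text \<open>No integrability is assumed, because a nonintegrable function has integral 0. This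
  allows the iterated integral that defines the form to be estimated before it is known to
  converge.\<close>

lemma ennreal_abs_integral_le:
  "ennreal \<bar>\<integral>x. f x \<partial>M\<bar> \<le> (\<integral>\<^sup>+x. ennreal \<bar>f x\<bar> \<partial>M)" for f :: "'a \<Rightarrow> real"
  using integral_norm_bound_ennreal[of M f] by (cases "integrable M f") (auto simp: not_integrable_integral_eq)

lemma L2_intervalD:
  assumes "f \<in> L2_interval a b"
  shows "f \<in> borel_measurable borel" "integrable lborel (\<lambda>x. (f x)\<^sup>2)" "x \<notin> {a<..<b} \<Longrightarrow> f x = 0"
  using assms by (auto simp: L2_interval_def)

lemma L2_interval_subset_bounded: "L2_interval a b \<subseteq> L2_bounded"
  by (auto simp: L2_bounded_def)

lemma L2_interval_dominated:
  assumes [measurable]: "f \<in> borel_measurable borel" and g: "g \<in> L2_interval a b"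
    and le: "\<And>x. \<bar>f x\<bar> \<le> c * \<bar>g x\<bar>"
  shows "f \<in> L2_interval a b"
proof -
  note g = L2_intervalD[OF g]
  have "integrable lborel (\<lambda>x. (f x)\<^sup>2)"
  proof (rule Bochner_Integration.integrable_bound)
    show "integrable lborel (\<lambda>x. c\<^sup>2 * (g x)\<^sup>2)" using g(2) by simp
    have "(f x)\<^sup>2 \<le> c\<^sup>2 * (g x)\<^sup>2" for x
      using power_mono[OF le[of x], of 2] by (simp add: power_mult_distrib)
    then show "AE x in lborel. norm ((f x)\<^sup>2) \<le> norm (c\<^sup>2 * (g x)\<^sup>2)" by auto
  qed simp
  moreover have "f x = 0" if "x \<notin> {a<..<b}" for x using le[of x] g(3)[OF that] by simp
  ultimately show ?thesis by (simp add: L2_interval_def)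
qed

lemma L2_interval_lincomb:
  assumes "f \<in> L2_interval a b" "g \<in> L2_interval a b"
  shows "(\<lambda>x. c * f x + d * g x) \<in> L2_interval a b"
proof -
  note f = L2_intervalD[OF assms(1)] and g = L2_intervalD[OF assms(2)]
  have [measurable]: "f \<in> borel_measurable borel" "g \<in> borel_measurable borel" using f g by auto
  have "integrable lborel (\<lambda>x. (c * f x + d * g x)\<^sup>2)"
  proof (rule Bochner_Integration.integrable_bound)
    show "integrable lborel (\<lambda>x. 2 * c\<^sup>2 * (f x)\<^sup>2 + 2 * d\<^sup>2 * (g x)\<^sup>2)" using f(2) g(2) by simp
    have "(p + q)\<^sup>2 \<le> 2 * p\<^sup>2 + 2 * q\<^sup>2" for p q :: real
      using zero_le_power2[of "p - q"] by (simp add: power2_sum power2_diff)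
    from this[of "c * f x" "d * g x" for x]
    show "AE x in lborel. norm ((c * f x + d * g x)\<^sup>2) \<le> norm (2 * c\<^sup>2 * (f x)\<^sup>2 + 2 * d\<^sup>2 * (g x)\<^sup>2)"
      by (auto simp: power_mult_distrib mult.assoc)
  qed simp
  then show ?thesis using f g by (simp add: L2_interval_def)
qed

lemma indicator_L2_interval [simp]:
  assumes "A \<in> sets borel" "A \<subseteq> {a<..<b}"
  shows "(indicator A :: real \<Rightarrow> real) \<in> L2_interval a b"
proof -
  have "emeasure lborel A < \<infinity>"
    using assms bounded_subset[OF bounded_box, of A a b] by (intro emeasure_bounded_finite) simp
  then have "integrable lborel (indicator A :: real \<Rightarrow> real)"
    using assms by (intro integrable_real_indicator) auto
  moreover have "(\<lambda>x. (indicator A x :: real)\<^sup>2) = indicator A" by (auto split: split_indicator)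
  ultimately show ?thesis using assms by (auto simp: L2_interval_def split: split_indicator)
qed

section \<open>Continuity of the embedding and a countable total family\<close>

locale covariance_kernel =
  fixes B :: "real \<Rightarrow> real" and J :: "(real \<Rightarrow> real) \<Rightarrow> 'g::{real_inner, complete_space}" and C :: real
  assumes iso: "isometric_embedding B J"
    and B_measurable [measurable]: "B \<in> borel_measurable borel"
    and C: "0 \<le> C" "(\<integral>\<^sup>+x. ennreal \<bar>B x\<bar> * indicator {-1<..<1} x \<partial>lborel) \<le> ennreal C"
begin

abbreviation "L2 \<equiv> L2_interval 0 1"

lemma J_lincomb: "f \<in> L2 \<Longrightarrow> g \<in> L2 \<Longrightarrow> J (\<lambda>x. c * f x + d * g x) = c *\<^sub>R J f + d *\<^sub>R J g"
  using iso L2_interval_subset_bounded unfolding isometric_embedding_def by blast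

lemma J_inner: "f \<in> L2 \<Longrightarrow> g \<in> L2 \<Longrightarrow> J f \<bullet> J g = (LINT s|lborel. LINT t|lborel. f s * g t * B (s - t))"
  using iso L2_interval_subset_bounded unfolding isometric_embedding_def by blast

lemma zero_L2 [simp]: "(\<lambda>_. 0) \<in> L2"
  by (simp add: L2_interval_def)

lemma J_zero: "J (\<lambda>_. 0) = 0"
  using J_lincomb[of "\<lambda>_. 0" "\<lambda>_. 0" 0 0] by simp

lemma J_sum:
  assumes "finite I" "\<And>i. i \<in> I \<Longrightarrow> f i \<in> L2"
  shows "(\<lambda>x. \<Sum>i\<in>I. c i * f i x) \<in> L2 \<and> J (\<lambda>x. \<Sum>i\<in>I. c i * f i x) = (\<Sum>i\<in>I. c i *\<^sub>R J (f i))"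
  using assms
proof (induction I rule: finite_induct)
  case empty then show ?case by (simp add: J_zero)
next
  case (insert i I)
  then show ?case
    using L2_interval_lincomb[of "f i" 0 1 "\<lambda>x. \<Sum>i\<in>I. c i * f i x" "c i" 1]
      J_lincomb[of "f i" "\<lambda>x. \<Sum>i\<in>I. c i * f i x" "c i" 1] by simp
qed

lemma kernel_translate: "(\<integral>\<^sup>+t. ennreal \<bar>B (s - t)\<bar> * indicator {-1<..<1} (s - t) \<partial>lborel) \<le> ennreal C"
  using nn_integral_real_affine[of "\<lambda>x. ennreal \<bar>B x\<bar> * indicator {-1<..<1} x" "-1" s] C by simp

lemma kernel_translate': "(\<integral>\<^sup>+s. ennreal \<bar>B (s - t)\<bar> * indicator {-1<..<1} (s - t) \<partial>lborel) \<le> ennreal C"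
  using nn_integral_real_affine[of "\<lambda>x. ennreal \<bar>B x\<bar> * indicator {-1<..<1} x" "1" "-t"] C by simp

text \<open>Schur's test: \<open>|f s * f t|\<close> is at most the mean of the two squares, and in
  each half the kernel is integrated over the variable missing from the square. Differences of
  points of \<open>(0, 1)\<close> lie in \<open>(-1, 1)\<close>, where \<open>C\<close> bounds the
  integral of the kernel.\<close>

lemma norm_J_le:
  assumes f: "f \<in> L2"
  shows "(norm (J f))\<^sup>2 \<le> C * (LINT x|lborel. (f x)\<^sup>2)"
proof -
  note fD = L2_intervalD[OF f]
  have [measurable]: "f \<in> borel_measurable borel" using fD by simp
  define K where "K x = ennreal \<bar>B x\<bar> * indicator {-1<..<1} x" for x
  have [measurable]: "K \<in> borel_measurable borel" unfolding K_def by measurable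
  define F where "F = (\<integral>\<^sup>+x. ennreal ((f x)\<^sup>2) \<partial>lborel)"
  have F: "F = ennreal (LINT x|lborel. (f x)\<^sup>2)"
    unfolding F_def by (intro nn_integral_eq_integral fD) auto
  have pt: "ennreal \<bar>f s * f t * B (s - t)\<bar> \<le> ennreal ((f s)\<^sup>2 / 2) * K (s - t) + ennreal ((f t)\<^sup>2 / 2) * K (s - t)" for s t
  proof (cases "s \<in> {0<..<1} \<and> t \<in> {0<..<1}")
    case True
    have "\<bar>f s * f t\<bar> \<le> (f s)\<^sup>2 / 2 + (f t)\<^sup>2 / 2"
      using zero_le_power2[of "\<bar>f s\<bar> - \<bar>f t\<bar>"] by (simp add: power2_diff abs_mult)
    then have "\<bar>f s * f t * B (s - t)\<bar> \<le> (f s)\<^sup>2 / 2 * \<bar>B (s - t)\<bar> + (f t)\<^sup>2 / 2 * \<bar>B (s - t)\<bar>"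
      unfolding abs_mult[of "f s * f t"] distrib_right[symmetric] by (intro mult_right_mono) auto
    moreover have "K (s - t) = ennreal \<bar>B (s - t)\<bar>" using True by (simp add: K_def)
    ultimately show ?thesis
      by (simp add: ennreal_plus[symmetric] ennreal_mult''[symmetric] ennreal_leI del: ennreal_plus)
  next
    case False
    then show ?thesis using fD(3)[of s] fD(3)[of t] by auto
  qed
  have half: "(\<integral>\<^sup>+x. ennreal ((f x)\<^sup>2 / 2) * ennreal C \<partial>lborel) = F * ennreal (C / 2)"
  proof -
    have "(\<integral>\<^sup>+x. ennreal ((f x)\<^sup>2 / 2) * ennreal C \<partial>lborel) = (\<integral>\<^sup>+x. ennreal ((f x)\<^sup>2) * ennreal (C / 2) \<partial>lborel)"
      using C(1) by (intro nn_integral_cong) (simp add: ennreal_mult''[symmetric] mult.commute)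
    then show ?thesis by (simp add: F_def nn_integral_multc)
  qed
  have "ennreal ((norm (J f))\<^sup>2) \<le> ennreal \<bar>LINT s|lborel. LINT t|lborel. f s * f t * B (s - t)\<bar>"
    unfolding power2_norm_eq_inner J_inner[OF f f] by (intro ennreal_leI) auto
  also have "\<dots> \<le> (\<integral>\<^sup>+s. ennreal \<bar>LINT t|lborel. f s * f t * B (s - t)\<bar> \<partial>lborel)"
    by (rule ennreal_abs_integral_le)
  also have "\<dots> \<le> (\<integral>\<^sup>+s. \<integral>\<^sup>+t. ennreal \<bar>f s * f t * B (s - t)\<bar> \<partial>lborel \<partial>lborel)"
    by (intro nn_integral_mono ennreal_abs_integral_le)
  also have "\<dots> \<le> (\<integral>\<^sup>+s. \<integral>\<^sup>+t. ennreal ((f s)\<^sup>2 / 2) * K (s - t) + ennreal ((f t)\<^sup>2 / 2) * K (s - t) \<partial>lborel \<partial>lborel)"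
    by (intro nn_integral_mono pt)
  also have "\<dots> = (\<integral>\<^sup>+s. \<integral>\<^sup>+t. ennreal ((f s)\<^sup>2 / 2) * K (s - t) \<partial>lborel \<partial>lborel) +
      (\<integral>\<^sup>+s. \<integral>\<^sup>+t. ennreal ((f t)\<^sup>2 / 2) * K (s - t) \<partial>lborel \<partial>lborel)"
    by (simp add: nn_integral_add)
  also have "(\<integral>\<^sup>+s. \<integral>\<^sup>+t. ennreal ((f t)\<^sup>2 / 2) * K (s - t) \<partial>lborel \<partial>lborel) =
      (\<integral>\<^sup>+t. \<integral>\<^sup>+s. ennreal ((f t)\<^sup>2 / 2) * K (s - t) \<partial>lborel \<partial>lborel)"
    by (rule lborel_pair.Fubini'[symmetric]) measurable
  also have "(\<integral>\<^sup>+s. \<integral>\<^sup>+t. ennreal ((f s)\<^sup>2 / 2) * K (s - t) \<partial>lborel \<partial>lborel) +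
      (\<integral>\<^sup>+t. \<integral>\<^sup>+s. ennreal ((f t)\<^sup>2 / 2) * K (s - t) \<partial>lborel \<partial>lborel) \<le> F * ennreal (C / 2) + F * ennreal (C / 2)"
  proof (rule add_mono)
    show "(\<integral>\<^sup>+s. \<integral>\<^sup>+t. ennreal ((f s)\<^sup>2 / 2) * K (s - t) \<partial>lborel \<partial>lborel) \<le> F * ennreal (C / 2)"
      unfolding half[symmetric] K_def using kernel_translate
      by (subst nn_integral_cmult) (auto intro!: nn_integral_mono mult_left_mono)
    show "(\<integral>\<^sup>+t. \<integral>\<^sup>+s. ennreal ((f t)\<^sup>2 / 2) * K (s - t) \<partial>lborel \<partial>lborel) \<le> F * ennreal (C / 2)"
      unfolding half[symmetric] K_def using kernel_translate'
      by (subst nn_integral_cmult) (auto intro!: nn_integral_mono mult_left_mono)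
  qed
  also have "F * ennreal (C / 2) + F * ennreal (C / 2) = ennreal (C * (LINT x|lborel. (f x)\<^sup>2))"
    unfolding F using C(1) by (simp add: ennreal_mult''[symmetric] ennreal_plus[symmetric] mult.commute del: ennreal_plus)
  finally show ?thesis
    using C(1) by (subst (asm) ennreal_le_iff) auto
qed

text \<open>Dominated convergence gives convergence in mean square, and \<open>norm_J_le\<close>
  transfers it to the images under \<open>J\<close>.\<close>

lemma J_mem_closed:
  assumes V: "closed V" and F: "\<And>n. F n \<in> L2" "\<And>n. J (F n) \<in> V"
    and f: "f \<in> L2" and g: "g \<in> L2"
    and lim: "\<And>x. (\<lambda>n. F n x) \<longlonglongrightarrow> f x" and le: "\<And>n x. \<bar>F n x\<bar> \<le> \<bar>g x\<bar>" "\<And>x. \<bar>f x\<bar> \<le> \<bar>g x\<bar>"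
  shows "J f \<in> V"
proof -
  have [measurable]: "f \<in> borel_measurable borel" "\<And>n. F n \<in> borel_measurable borel"
    using L2_intervalD f F(1) by auto
  have diff: "(\<lambda>x. F n x - f x) \<in> L2" "J (\<lambda>x. F n x - f x) = J (F n) - J f" for n
    using L2_interval_lincomb[OF F(1)[of n] f, of 1 "-1"] J_lincomb[OF F(1)[of n] f, of 1 "-1"] by simp_all
  have "(\<lambda>n. LINT x|lborel. (F n x - f x)\<^sup>2) \<longlonglongrightarrow> integral\<^sup>L (lborel :: real measure) (\<lambda>_. 0 :: real)"
  proof (rule integral_dominated_convergence)
    show "integrable lborel (\<lambda>x. 4 * (g x)\<^sup>2)" using L2_intervalD(2)[OF g] by simp
    show "AE x in lborel. (\<lambda>n. (F n x - f x)\<^sup>2) \<longlonglongrightarrow> 0"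
      using LIM_zero[OF lim] by simp
    have "\<bar>F n x - f x\<bar> \<le> 2 * \<bar>g x\<bar>" for n x using le(1)[of n x] le(2)[of x] by linarith
    then have "(F n x - f x)\<^sup>2 \<le> 4 * (g x)\<^sup>2" for n x
      using power_mono[of "\<bar>F n x - f x\<bar>" "2 * \<bar>g x\<bar>" 2] by (simp add: power_mult_distrib)
    then show "AE x in lborel. norm ((F n x - f x)\<^sup>2) \<le> 4 * (g x)\<^sup>2" for n by simp
  qed auto
  then have "(\<lambda>n. C * (LINT x|lborel. (F n x - f x)\<^sup>2)) \<longlonglongrightarrow> 0"
    by (auto intro!: tendsto_eq_intros)
  then have "(\<lambda>n. (norm (J (F n) - J f))\<^sup>2) \<longlonglongrightarrow> 0"
    by (rule Lim_null_comparison[rotated]) (use norm_J_le[OF diff(1)] diff(2) in auto)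
  then have "(\<lambda>n. norm (J (F n) - J f)) \<longlonglongrightarrow> 0"
    using tendsto_real_sqrt[of "\<lambda>n. (norm (J (F n) - J f))\<^sup>2" 0] by simp
  then have "(\<lambda>n. J (F n) - J f) \<longlonglongrightarrow> 0" by (rule tendsto_norm_zero_cancel)
  then have "(\<lambda>n. J (F n)) \<longlonglongrightarrow> J f" by (rule LIM_zero_cancel)
  then show ?thesis using closed_sequentially[OF V, of "\<lambda>n. J (F n)"] F(2) by simp
qed

lemma subspace_J_image: "subspace (J ` L2)"
  unfolding subspace_def
proof (intro conjI ballI allI)
  show "0 \<in> J ` L2" using J_zero zero_L2 by (metis imageI)
  fix x y c assume "x \<in> J ` L2" "y \<in> J ` L2"
  then obtain f g where "f \<in> L2" "g \<in> L2" "x = J f" "y = J g" by auto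
  then show "x + y \<in> J ` L2" "c *\<^sub>R x \<in> J ` L2"
    using J_lincomb[of f g 1 1] J_lincomb[of f g c 0] L2_interval_lincomb[of f 0 1 g 1 1] L2_interval_lincomb[of f 0 1 g c 0]
    by (auto simp: image_iff) (metis, metis)
qed

text \<open>The rationals are enumerated because the orthogonal basis is built from a sequence of
  vectors.\<close>

definition cut :: "nat \<Rightarrow> 'g" where
  "cut k = J (indicator ({0<..<1} \<inter> {..<real_of_rat (from_nat_into UNIV k)}))"

lemma J_mem_closure_span_cut:
  assumes f: "f \<in> L2"
  shows "J f \<in> closure (span (range cut))"
proof -
  let ?V = "closure (span (range cut))" and ?U = "{0<..<1::real}"
  have sub: "subspace ?V" by (intro subspace_closure subspace_span)
  have one: "(indicator ?U :: real \<Rightarrow> real) \<in> L2" by simp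
  have ind: "J (indicator (?U \<inter> A)) \<in> ?V" if A: "A \<in> sets borel" for A
  proof -
    have borel: "S \<in> sets borel" if "S \<in> sigma_sets UNIV (range lessThan)" for S :: "real set"
      using that by (simp add: borel_Iio)
    have "Int_stable (range (lessThan :: real \<Rightarrow> real set))"
    proof -
      have "{..<a} \<inter> {..<b} = {..<min a b}" for a b :: real by auto
      then show ?thesis by (auto simp: Int_stable_def)
    qed
    moreover have "range (lessThan :: real \<Rightarrow> real set) \<subseteq> Pow UNIV" by simp
    moreover have "A \<in> sigma_sets UNIV (range lessThan)" using A by (simp add: borel_Iio)
    ultimately show ?thesis
    proof (induction A rule: sigma_sets_induct_disjoint)
      case (basic S)
      then obtain x where S: "S = {..<x}" by auto
      \<comment> \<open>Rationals approaching \<open>x\<close> strictly from below: their rays never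
        contain a point \<open>y >= x\<close> and eventually contain each
        \<open>y < x\<close>.\<close>
      have ex: "\<exists>r. x - inverse (Suc n) < real_of_rat r \<and> real_of_rat r < x" for n
        using of_rat_dense[of "x - inverse (Suc n)" x] by auto
      define q where "q n = (SOME r. x - inverse (Suc n) < real_of_rat r \<and> real_of_rat r < x)" for n
      have q: "x - inverse (Suc n) < real_of_rat (q n)" "real_of_rat (q n) < x" for n
        using someI_ex[OF ex[of n]] unfolding q_def by auto
      show ?case
      proof (rule J_mem_closed[OF closed_closure, where F = "\<lambda>n. indicator (?U \<inter> {..<real_of_rat (q n)})" and g = "indicator ?U"])
        show "J (indicator (?U \<inter> {..<real_of_rat (q n)})) \<in> ?V" for n
        proof -
          have "J (indicator (?U \<inter> {..<real_of_rat (q n)})) = cut (to_nat_on UNIV (q n))"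
            by (simp add: cut_def)
          then show ?thesis using closure_subset span_base by (metis rangeI subsetD)
        qed
        fix y
        show "(\<lambda>n. indicator (?U \<inter> {..<real_of_rat (q n)}) y) \<longlonglongrightarrow> (indicator (?U \<inter> S) y :: real)"
        proof (cases "y < x")
          case True
          have "(\<lambda>n. inverse (real (Suc n))) \<longlonglongrightarrow> 0" by (rule LIMSEQ_inverse_real_of_nat)
          then have "\<forall>\<^sub>F n in sequentially. inverse (real (Suc n)) < x - y"
            using True by (intro order_tendstoD) auto
          then have "\<forall>\<^sub>F n in sequentially. indicator (?U \<inter> {..<real_of_rat (q n)}) y = (indicator (?U \<inter> S) y :: real)"
          proof eventually_elim
            case (elim n)
            then show ?case using q(1)[of n] True S by (auto split: split_indicator)
          qed
          then show ?thesis by (rule tendsto_eventually)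
        next
          case False
          then have "indicator (?U \<inter> {..<real_of_rat (q n)}) y = (indicator (?U \<inter> S) y :: real)" for n
            using q(2)[of n] S by (auto split: split_indicator)
          then show ?thesis by simp
        qed
      qed (use S in \<open>auto split: split_indicator\<close>)
    next
      case empty
      show ?case using subspace_0[OF sub] by (simp add: J_zero)
    next
      case (compl S)
      have "J (indicator (?U \<inter> (UNIV - S))) = J (\<lambda>x. 1 * indicator ?U x + (-1) * indicator (?U \<inter> S) x)"
        by (intro arg_cong[where f = J]) (auto split: split_indicator)
      also have "\<dots> = J (indicator ?U) - J (indicator (?U \<inter> S))"
        using compl borel by (subst J_lincomb) auto
      also have "\<dots> \<in> ?V"
      proof (intro subspace_diff[OF sub] compl)
        have "?U \<inter> {..<1} = ?U" by auto
        then have "J (indicator ?U) = cut (to_nat_on UNIV (1 :: rat))" by (simp add: cut_def)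
        then show "J (indicator ?U) \<in> ?V" using closure_subset span_base by (metis rangeI subsetD)
      qed
      finally show ?case .
    next
      case (union A)
      have borelA: "A i \<in> sets borel" for i using union(2) borel by blast
      \<comment> \<open>Disjointness turns the indicator of a finite partial union into a sum, to
        which linearity of \<open>J\<close> applies.\<close>
      let ?F = "\<lambda>n. indicator (?U \<inter> (\<Union>i<n. A i)) :: real \<Rightarrow> real"
      show ?case
      proof (rule J_mem_closed[OF closed_closure, where F = ?F and g = "indicator ?U"])
        fix n
        have "?F n = (\<lambda>x. \<Sum>i<n. 1 * indicator (?U \<inter> A i) x)"
          using disjoint_family_on_mono[OF subset_UNIV union(1)]
          by (intro ext) (simp add: indicator_inter_arith indicator_UN_disjoint flip: sum_distrib_left)
        moreover have "J (\<lambda>x. \<Sum>i<n. 1 * indicator (?U \<inter> A i) x) = (\<Sum>i<n. 1 *\<^sub>R J (indicator (?U \<inter> A i)))"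
          using borelA by (intro conjunct2[OF J_sum]) auto
        ultimately show "J (?F n) \<in> ?V"
          using union(3) by (simp add: subspace_sum[OF sub])
      next
        fix x
        show "(\<lambda>n. ?F n x) \<longlonglongrightarrow> indicator (?U \<inter> (\<Union>i. A i)) x"
        proof (cases "\<exists>i. x \<in> A i")
          case True
          then obtain i where i: "x \<in> A i" by blast
          have "\<forall>\<^sub>F n in sequentially. ?F n x = indicator (?U \<inter> (\<Union>i. A i)) x"
            using eventually_gt_at_top[of i]
            by eventually_elim (use i in \<open>auto split: split_indicator\<close>)
          then show ?thesis by (rule tendsto_eventually)
        next
          case False
          then show ?thesis by simp
        qed
      qed (use borelA in \<open>auto split: split_indicator\<close>)
    qed
  qed
  note fD = L2_intervalD[OF f]
  \<comment> \<open>Approximation relative to the base point 0 gives domination by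
    \<open>2 * |f|\<close>, which also forces \<open>F n\<close> to vanish outside
    \<open>(0, 1)\<close>.\<close>
  obtain F where F: "\<And>n. simple_function borel (F n)" "\<And>x. (\<lambda>n. F n x) \<longlonglongrightarrow> f x"
    and le: "\<And>n x. \<bar>F n x\<bar> \<le> 2 * \<bar>f x\<bar>"
    using borel_measurable_implies_sequence_metric[OF fD(1), of 0] by (auto simp: dist_real_def)
  have FL2: "F n \<in> L2" for n
    using borel_measurable_simple_function[OF F(1)[of n]] le by (intro L2_interval_dominated[OF _ f]) auto
  show ?thesis
  proof (rule J_mem_closed[OF closed_closure FL2 _ f _ F(2)])
    show "(\<lambda>x. 2 * f x) \<in> L2" using L2_interval_lincomb[OF f f, of 2 0] by simp
    fix n
    have fin: "finite (range (F n))" using F(1)[of n] by (auto simp: simple_function_def)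
    have pre: "F n -` {y} \<in> sets borel" for y
      using measurable_sets_borel[OF borel_measurable_simple_function[OF F(1)[of n]]] by simp
    \<comment> \<open>The preimage of 0 is unbounded. Intersecting with \<open>?U\<close> keeps all
      the indicators in \<open>L2\<close> and preserves the sum, as \<open>F n\<close> vanishes off
      \<open>?U\<close>.\<close>
    have "F n = (\<lambda>x. \<Sum>y\<in>range (F n). y * indicator (?U \<inter> F n -` {y}) x)"
    proof
      fix x
      show "F n x = (\<Sum>y\<in>range (F n). y * indicator (?U \<inter> F n -` {y}) x)"
      proof (cases "x \<in> ?U")
        case True
        then have "(\<Sum>y\<in>range (F n). y * indicator (?U \<inter> F n -` {y}) x) = (\<Sum>y\<in>range (F n). if F n x = y then y else 0)"
          by (intro sum.cong) (auto split: split_indicator)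
        then show ?thesis using fin by simp
      next
        case False
        then show ?thesis by (subst sum.neutral) (auto simp: L2_intervalD(3)[OF FL2])
      qed
    qed
    moreover have "J (\<lambda>x. \<Sum>y\<in>range (F n). y * indicator (?U \<inter> F n -` {y}) x) =
        (\<Sum>y\<in>range (F n). y *\<^sub>R J (indicator (?U \<inter> F n -` {y})))"
      using fin pre by (intro conjunct2[OF J_sum]) auto
    ultimately show "J (F n) \<in> closure (span (range cut))"
      using ind[OF pre] by (simp add: subspace_sum[OF sub] subspace_scale[OF sub])
  qed (use le in \<open>auto simp: abs_mult\<close>)
qed

lemma G_space_eq_closure_span_cut: "G_space J 0 1 = closure (span (range cut))"
proof (rule antisym)
  show "G_space J 0 1 \<subseteq> closure (span (range cut))"
    unfolding G_space_def using J_mem_closure_span_cut by (intro closure_minimal) auto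
  have "range cut \<subseteq> J ` L2" by (auto simp: cut_def)
  then have "span (range cut) \<subseteq> J ` L2" by (rule span_minimal) (rule subspace_J_image)
  then show "closure (span (range cut)) \<subseteq> G_space J 0 1"
    unfolding G_space_def by (rule closure_mono)
qed

lemma norm_admissible: "norm \<in> G_admissible J 0 1"
  by (simp add: G_admissible_def G_space_eq_closure_span_cut FHS_equivalent_norm)

lemma subspace_G_space: "subspace (G_space J 0 1)"
  unfolding G_space_eq_closure_span_cut by (intro subspace_closure subspace_span)

end

section \<open>Decreasing kernels and indicators of grid intervals\<close>

locale monotone_covariance_kernel = covariance_kernel B J C
  for B :: "real \<Rightarrow> real" and J :: "(real \<Rightarrow> real) \<Rightarrow> 'g::{real_inner, complete_space}" and C :: real +
  assumes even: "t \<noteq> 0 \<Longrightarrow> B (- t) = B t"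
    and nonneg: "0 < t \<Longrightarrow> 0 \<le> B t"
    and antimono: "antimono_on {0<..} B"
begin

lemma B_nonneg: "t \<noteq> 0 \<Longrightarrow> 0 \<le> B t"
  using nonneg[of t] nonneg[of "-t"] even[of t] by (cases "t > 0") auto

lemma B_ge: "t \<noteq> 0 \<Longrightarrow> \<bar>t\<bar> \<le> h \<Longrightarrow> B h \<le> B t"
  using antimono[THEN monotone_onD, of t h] antimono[THEN monotone_onD, of "-t" h] even[of t]
  by (cases "t > 0") auto

lemma J_inner_nonneg:
  assumes "f \<in> L2" "g \<in> L2" "\<And>x. 0 \<le> f x" "\<And>x. 0 \<le> g x"
  shows "0 \<le> J f \<bullet> J g"
proof -
  have "0 \<le> (LINT t|lborel. f s * g t * B (s - t))" for s
  proof (rule integral_nonneg_AE)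
    \<comment> \<open>The sign of \<open>B 0\<close> is not controlled, so the diagonal point
      \<open>t = s\<close> is discarded as a null set.\<close>
    show "AE t in lborel. 0 \<le> f s * g t * B (s - t)"
      using AE_lborel_singleton[of s]
      by eventually_elim (use assms(3,4) B_nonneg in auto)
  qed
  then show ?thesis unfolding J_inner[OF assms(1,2)] by (intro integral_nonneg_AE) auto
qed

text \<open>Points of two adjacent intervals of length \<open>h\<close> are less than
  \<open>2 * h\<close> apart, so the kernel is at least \<open>B (2 * h)\<close> on a rectangle of
  area \<open>h^2\<close>.\<close>

lemma J_inner_adjacent:
  assumes a: "0 \<le> a" "0 < h" "a + 2 * h \<le> 1"
  shows "h\<^sup>2 * B (2 * h) \<le> J (indicator {a<..<a + h}) \<bullet> J (indicator {a + h<..<a + 2 * h})"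
proof -
  let ?f = "indicator {a<..<a + h} :: real \<Rightarrow> real" and ?g = "indicator {a + h<..<a + 2 * h} :: real \<Rightarrow> real"
  let ?H = "\<lambda>s. LINT t|lborel. ?f s * ?g t * B (s - t)"
  have L2: "?f \<in> L2" "?g \<in> L2" using a by (auto intro!: indicator_L2_interval)
  \<comment> \<open>The comparison is between Bochner integrals, which would be 0 if they diverged;
    this bound supplies the integrability, first in \<open>t\<close> and then in
    \<open>s\<close>.\<close>
  have bound: "(\<integral>\<^sup>+t. ennreal \<bar>?f s * ?g t * B (s - t)\<bar> \<partial>lborel) \<le> ennreal C" for s
  proof -
    have "(\<integral>\<^sup>+t. ennreal \<bar>?f s * ?g t * B (s - t)\<bar> \<partial>lborel) \<le>
        (\<integral>\<^sup>+t. ennreal \<bar>B (s - t)\<bar> * indicator {-1<..<1} (s - t) \<partial>lborel)"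
      using a by (intro nn_integral_mono) (auto split: split_indicator)
    also have "\<dots> \<le> ennreal C" by (rule kernel_translate)
    finally show ?thesis .
  qed
  have int: "integrable lborel (\<lambda>t. ?f s * ?g t * B (s - t))" for s
    using bound[of s] by (intro integrableI_bounded) (auto intro: le_less_trans)
  have H_le: "\<bar>?H s\<bar> \<le> C" for s
    using order_trans[OF ennreal_abs_integral_le bound[of s]] C(1) by simp
  have H_ge: "?f s * (h * B (2 * h)) \<le> ?H s" for s
  proof -
    have "(LINT t|lborel. ?f s * ?g t * B (2 * h)) \<le> ?H s"
    proof (intro integral_mono int)
      show "integrable lborel (\<lambda>t. ?f s * ?g t * B (2 * h))"
        using a by (intro integrable_mult_left integrable_mult_right integrable_real_indicator) auto
      show "?f s * ?g t * B (2 * h) \<le> ?f s * ?g t * B (s - t)" for t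
        using B_ge[of "s - t" "2 * h"] by (auto split: split_indicator)
    qed
    moreover have "(LINT t|lborel. ?f s * ?g t * B (2 * h)) = ?f s * (h * B (2 * h))"
    proof -
      have "measure lborel {a + h<..<a + 2 * h} = h" using a by (subst measure_lborel_Ioo) auto
      then show ?thesis by simp
    qed
    ultimately show ?thesis by (simp only:)
  qed
  have "(LINT s|lborel. ?f s * (h * B (2 * h))) \<le> (LINT s|lborel. ?H s)"
  proof (rule integral_mono[OF _ _ H_ge])
    show "integrable lborel (\<lambda>s. ?f s * (h * B (2 * h)))"
      using a by (intro integrable_mult_left integrable_real_indicator) auto
    show "integrable lborel ?H"
    proof (rule Bochner_Integration.integrable_bound)
      show "integrable lborel (\<lambda>s. C * ?f s)"
        using a by (intro integrable_mult_right integrable_real_indicator) auto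
      show "?H \<in> borel_measurable lborel" by measurable
      show "AE s in lborel. norm (?H s) \<le> norm (C * ?f s)"
      proof (rule AE_I2)
        show "norm (?H s) \<le> norm (C * ?f s)" for s
        proof (cases "s \<in> {a<..<a + h}")
          case True
          then have "norm (C * ?f s) = C" using C(1) by simp
          then show ?thesis using H_le[of s] by (simp only: real_norm_def)
        qed simp
      qed
    qed
  qed
  moreover have "(LINT s|lborel. ?f s * (h * B (2 * h))) = h\<^sup>2 * B (2 * h)"
  proof -
    have "measure lborel {a<..<a + h} = h" using a by (subst measure_lborel_Ioo) auto
    then show ?thesis by (simp add: power2_eq_square)
  qed
  ultimately show ?thesis unfolding J_inner[OF L2] by (simp only:)
qed

definition block :: "nat \<Rightarrow> nat \<Rightarrow> real set" where
  "block n i = {real i / real n<..<real (Suc i) / real n}"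

lemma block_measurable [measurable]: "block n i \<in> sets borel"
  by (simp add: block_def)

lemma block_subset:
  assumes "i < n"
  shows "block n i \<subseteq> {0<..<1}"
proof -
  have "real (Suc i) / real n \<le> 1" "0 \<le> real i / real n"
    using assms by (simp_all add: divide_le_eq)
  then show ?thesis unfolding block_def by (metis greaterThanLessThan_subseteq_greaterThanLessThan)
qed

lemma block_L2: "i < n \<Longrightarrow> indicator (block n i) \<in> L2"
  using block_subset by (intro indicator_L2_interval) (auto simp: block_def)

text \<open>The double sum is the squared norm of the image of one indicator, that of the union of
  the disjoint blocks. As this union lies in \<open>(0, 1)\<close>, the bound does not depend on
  \<open>n\<close>.\<close>

lemma sum_inner_block_le:
  assumes n: "0 < n"
  shows "(\<Sum>i<n. \<Sum>j<n. J (indicator (block n i)) \<bullet> J (indicator (block n j))) \<le> C"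
proof -
  have disj: "disjoint_family_on (block n) {..<n}"
  proof (unfold disjoint_family_on_def, intro ballI impI)
    fix i j :: nat assume "i \<noteq> j"
    then consider "Suc i \<le> j" | "Suc j \<le> i" by linarith
    then have "real (Suc i) / real n \<le> real j / real n \<or> real (Suc j) / real n \<le> real i / real n"
      by cases (simp_all add: divide_right_mono del: of_nat_Suc)
    then show "block n i \<inter> block n j = {}" by (auto simp: block_def)
  qed
  define U where "U = (\<Union>i<n. block n i)"
  have U: "U \<in> sets borel" "U \<subseteq> {0<..<1}"
    unfolding U_def using block_subset[of _ n] by (auto intro!: sets.finite_UN simp: block_measurable)
  have sum: "(\<lambda>x. \<Sum>i<n. 1 * indicator (block n i) x) = (indicator (\<Union>i<n. block n i) :: real \<Rightarrow> real)"
    using disj by (intro ext) (simp add: indicator_UN_disjoint)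
  have "(\<Sum>i<n. \<Sum>j<n. J (indicator (block n i)) \<bullet> J (indicator (block n j))) =
      (norm (\<Sum>i<n. 1 *\<^sub>R J (indicator (block n i))))\<^sup>2"
    by (simp add: power2_norm_eq_inner inner_sum_left inner_sum_right) (intro sum.cong refl inner_commute)
  also have "(\<Sum>i<n. 1 *\<^sub>R J (indicator (block n i))) = J (indicator U)"
    unfolding U_def sum[symmetric] using block_L2 by (intro conjunct2[OF J_sum, symmetric]) auto
  also have "(norm (J (indicator U)))\<^sup>2 \<le> C * (LINT x|lborel. (indicator U x)\<^sup>2)"
    using U by (intro norm_J_le indicator_L2_interval)
  also have "(LINT x|lborel. (indicator U x)\<^sup>2 :: real) \<le> (LINT x|lborel. indicator {0<..<1::real} x)"
    using U L2_intervalD(2)[OF indicator_L2_interval[OF U]]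
    by (intro integral_mono integrable_real_indicator) (auto split: split_indicator)
  also have "(LINT x|lborel. indicator {0<..<1::real} x) = (1::real)" by simp
  finally show ?thesis using C(1) by (simp add: mult_left_mono)
qed

lemma norm_block_le:
  assumes "i < n"
  shows "(norm (J (indicator (block n i))))\<^sup>2 \<le> C / n"
proof -
  have "(LINT x|lborel. (indicator (block n i) x)\<^sup>2 :: real) = (LINT x|lborel. indicator (block n i) x)"
    by (intro Bochner_Integration.integral_cong) (auto split: split_indicator)
  also have "\<dots> = 1 / n"
    using assms by (simp add: block_def divide_right_mono) (simp add: field_simps)
  finally show ?thesis using norm_J_le[OF block_L2[OF assms]] by simp
qed

end

section \<open>Kernels with a logarithmic singularity\<close>

text \<open>A convex function on an open half-line is continuous. Evenness supplies the reflected
  half, and the value at 0 is added separately.\<close>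

lemma borel_measurable_even_convex:
  fixes B :: "real \<Rightarrow> real"
  assumes even: "\<And>t. t \<noteq> 0 \<Longrightarrow> B (- t) = B t" and convex: "convex_on {0<..} B"
  shows "B \<in> borel_measurable borel"
proof -
  have "continuous_on {0<..} B" by (intro convex_on_continuous convex) simp
  then have ind [measurable]: "(\<lambda>x. indicator {0<..} x *\<^sub>R B x) \<in> borel_measurable borel"
    by (intro borel_measurable_continuous_on_indicator) auto
  have "(\<lambda>x. indicator {0<..} (- x) *\<^sub>R B (- x)) \<in> borel_measurable borel"
    by (rule measurable_compose[OF _ ind]) simp
  then have "(\<lambda>x. indicator {0<..} x *\<^sub>R B x + indicator {0<..} (- x) *\<^sub>R B (- x) + B 0 * indicator {0} x)
      \<in> borel_measurable borel" by measurable
  also have "(\<lambda>x. indicator {0<..} x *\<^sub>R B x + indicator {0<..} (- x) *\<^sub>R B (- x) + B 0 * indicator {0} x) = B"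
    using even by (intro ext) (auto split: split_indicator)
  finally show ?thesis .
qed

text \<open>An antiderivative is \<open>ln (1 / t) powr (1 - \<alpha>) / (\<alpha> - 1)\<close>. It
  tends to 0 at the origin because \<open>\<alpha> > 1\<close>, and \<open>\<delta> < 1\<close>
  keeps the logarithm positive.\<close>

lemma set_integrable_inverse_ln_powr:
  fixes \<alpha> \<delta> :: real
  assumes "1 < \<alpha>" "0 < \<delta>" "\<delta> < 1"
  shows "set_integrable lborel {0<..<\<delta>} (\<lambda>t. 1 / (t * ln (1 / t) powr \<alpha>))"
proof -
  let ?f = "\<lambda>t. 1 / (t * ln (1 / t) powr \<alpha>)" and ?G = "\<lambda>t. ln (1 / t) powr (1 - \<alpha>) / (\<alpha> - 1)"
  have "set_integrable lborel (einterval 0 (ereal \<delta>)) ?f"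
  proof (rule interval_integral_FTC_nonneg(1)[where F = ?G])
    show "0 < ereal \<delta>" using assms by simp
    fix x assume "0 < ereal x" "ereal x < ereal \<delta>"
    then have x: "0 < x" "x < 1" using assms by auto
    then have ln: "0 < ln (1 / x)" by simp
    have "((\<lambda>t. ln (1 / t)) has_real_derivative - (1 / x)) (at x)"
      using x by (auto intro!: derivative_eq_intros simp: field_simps power2_eq_square)
    from DERIV_cdivide[OF DERIV_chain2[OF has_real_derivative_powr[OF ln, of "1 - \<alpha>"] this], of "\<alpha> - 1"]
    have "(?G has_real_derivative (1 - \<alpha>) * ln (1 / x) powr (1 - \<alpha> - 1) * - (1 / x) / (\<alpha> - 1)) (at x)" .
    also have "(1 - \<alpha>) * ln (1 / x) powr (1 - \<alpha> - 1) * - (1 / x) / (\<alpha> - 1) = ln (1 / x) powr (- \<alpha>) / x"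
      using x assms by (simp add: field_simps)
    also have "\<dots> = ?f x" by (simp add: powr_minus_divide)
    finally show "(?G has_real_derivative ?f x) (at x)" .
    show "isCont ?f x" using x ln by (auto intro!: continuous_intros)
  next
    show "AE x in lborel. 0 < ereal x \<longrightarrow> ereal x < ereal \<delta> \<longrightarrow> 0 \<le> ?f x"
      by auto
    have "filterlim (\<lambda>x::real. ln (1 / x)) at_top (at_right 0)"
      by (intro filterlim_compose[OF ln_at_top] filterlim_inverse_at_top_right[unfolded inverse_eq_divide])
    then have "((\<lambda>x. ln (1 / x) powr (1 - \<alpha>)) \<longlongrightarrow> 0) (at_right (0::real))"
      using assms by (intro tendsto_neg_powr) auto
    then have "(?G \<longlongrightarrow> 0) (at_right 0)" by (rule tendsto_divide_zero)
    then show "((?G \<circ> real_of_ereal) \<longlongrightarrow> 0) (at_right 0)"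
      by (simp add: zero_ereal_def ereal_tendsto_simps)
    have "(?G \<longlongrightarrow> ?G \<delta>) (at_left \<delta>)"
      using assms by (intro tendsto_intros) auto
    then show "((?G \<circ> real_of_ereal) \<longlongrightarrow> ?G \<delta>) (at_left (ereal \<delta>))"
      by (simp add: ereal_tendsto_simps)
  qed
  then show ?thesis by (simp add: einterval_eq zero_ereal_def)
qed

text \<open>For \<open>|x| < \<delta>\<close> the integrability at the origin and its mirror image
  suffice; for larger \<open>|x|\<close> monotonicity bounds the kernel by
  \<open>B \<delta>\<close>. The origin itself is a null set.\<close>

lemma nn_integral_even_kernel_finite:
  fixes B :: "real \<Rightarrow> real"
  assumes [measurable]: "B \<in> borel_measurable borel"
    and even: "\<And>t. t \<noteq> 0 \<Longrightarrow> B (- t) = B t" and nonneg: "\<And>t. 0 < t \<Longrightarrow> 0 \<le> B t"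
    and antimono: "antimono_on {0<..} B"
    and \<delta>: "0 < \<delta>" and int: "set_integrable lborel {0<..<\<delta>} B"
  shows "(\<integral>\<^sup>+x. ennreal \<bar>B x\<bar> * indicator {-1<..<1} x \<partial>lborel) < \<infinity>"
proof -
  let ?g = "\<lambda>x. ennreal \<bar>B x\<bar> * indicator {0<..<\<delta>} x"
  have fin: "(\<integral>\<^sup>+x. ?g x \<partial>lborel) < \<infinity>"
  proof -
    have "(\<integral>\<^sup>+x. ?g x \<partial>lborel) = (\<integral>\<^sup>+x. ennreal (norm (indicator {0<..<\<delta>} x *\<^sub>R B x)) \<partial>lborel)"
      by (intro nn_integral_cong) (auto split: split_indicator)
    also have "\<dots> < \<infinity>" using int unfolding set_integrable_def integrable_iff_bounded by blast
    finally show ?thesis .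
  qed
  have "(\<integral>\<^sup>+x. ennreal \<bar>B x\<bar> * indicator {-1<..<1} x \<partial>lborel) \<le>
      (\<integral>\<^sup>+x. ?g x + ?g (- x) + ennreal (B \<delta>) * indicator {-1<..<1} x \<partial>lborel)"
  proof (rule nn_integral_mono_AE)
    show "AE x in lborel. ennreal \<bar>B x\<bar> * indicator {-1<..<1} x \<le> ?g x + ?g (- x) + ennreal (B \<delta>) * indicator {-1<..<1} x"
      using AE_lborel_singleton[of 0]
    proof eventually_elim
      case (elim x)
      have B: "B x = B \<bar>x\<bar>" "0 \<le> B \<bar>x\<bar>" using elim even[of x] nonneg[of "\<bar>x\<bar>"] by (auto simp: abs_if)
      show ?case
      proof (cases "\<bar>x\<bar> < \<delta>")
        case True
        then show ?thesis using elim even[of x] by (cases "0 < x") (auto split: split_indicator)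
      next
        case False
        then have "B \<bar>x\<bar> \<le> B \<delta>" using antimono[THEN monotone_onD, of \<delta> "\<bar>x\<bar>"] \<delta> by auto
        then have "ennreal \<bar>B x\<bar> \<le> ennreal (B \<delta>)" using B by (intro ennreal_leI) simp
        then show ?thesis by (auto split: split_indicator intro: add_increasing)
      qed
    qed
  qed
  also have "\<dots> = (\<integral>\<^sup>+x. ?g x \<partial>lborel) + (\<integral>\<^sup>+x. ?g (- x) \<partial>lborel) + ennreal (B \<delta>) * 2"
    by (simp add: nn_integral_add nn_integral_cmult)
  also have "(\<integral>\<^sup>+x. ?g (- x) \<partial>lborel) = (\<integral>\<^sup>+x. ?g x \<partial>lborel)"
    using nn_integral_real_affine[of ?g "-1" 0] by simp
  also have "(\<integral>\<^sup>+x. ?g x \<partial>lborel) + (\<integral>\<^sup>+x. ?g x \<partial>lborel) + ennreal (B \<delta>) * 2 < \<infinity>"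
    using fin by (simp add: ennreal_mult_less_top)
  finally show ?thesis .
qed

text \<open>By Borel-Cantelli, almost every point for \<open>P\<close> is eventually outside
  \<open>A j\<close>, which passes to \<open>Q\<close> by absolute continuity. For \<open>Q\<close>,
  almost every point is eventually inside \<open>A j\<close>.\<close>

lemma separating_events:
  assumes P: "prob_space P" and Q: "prob_space Q" and sets: "sets Q = sets P"
    and ac: "absolutely_continuous P Q"
    and A: "\<And>j :: nat. A j \<in> sets P"
    and sP: "summable (\<lambda>j. measure P (A j))" and sQ: "summable (\<lambda>j. measure Q (space P - A j))"
  shows False
proof -
  interpret P: prob_space P by fact
  interpret Q: prob_space Q by fact
  have sp: "space Q = space P" by (rule sets_eq_imp_space_eq[OF sets])
  have "AE x in P. eventually (\<lambda>j. x \<in> space P - A j) sequentially"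
    using A sP by (intro borel_cantelli_AE1) (auto simp: P.emeasure_eq_measure)
  then have "AE x in Q. eventually (\<lambda>j. x \<in> space P - A j) sequentially"
    by (rule absolutely_continuous_AE[OF sets ac])
  moreover have "AE x in Q. eventually (\<lambda>j. x \<in> space Q - (space P - A j)) sequentially"
    using A sQ sets by (intro borel_cantelli_AE1) (auto simp: Q.emeasure_eq_measure)
  ultimately have "AE x in Q. False"
  proof eventually_elim
    case (elim x)
    then have "eventually (\<lambda>j::nat. False) sequentially" by eventually_elim auto
    then show False by simp
  qed
  then show False by simp
qed

section \<open>Absence of units\<close>

text \<open>An admissible norm selects a measure with the prescribed distributions. Almost sure
  linearity moves to it because equivalent measures share their null sets.\<close>

lemma gaussian_field_of_type:
  assumes type: "gaussian_type E adm M \<xi>" and norm: "norm \<in> adm" and sub: "subspace E"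
  obtains \<gamma> where "\<gamma> \<in> measure_type M" "gaussian_field \<gamma> E \<xi>"
proof -
  obtain \<gamma> where \<gamma>: "\<gamma> \<in> measure_type M" and distr: "\<And>f. f \<in> E \<Longrightarrow> distr \<gamma> borel (\<xi> f) = centered_normal (norm f)"
    using type norm unfolding gaussian_type_def by blast
  have "gaussian_field \<gamma> E \<xi>"
  proof (intro gaussian_field.intro gaussian_field_axioms.intro)
    show "prob_space \<gamma>" using \<gamma> by (simp add: measure_type_def)
    show "\<xi> f \<in> borel_measurable \<gamma>" if "f \<in> E" for f
      using type that \<gamma> measurable_cong_sets[of \<gamma> M borel borel]
      by (auto simp: gaussian_type_def measure_type_def)
    show "AE x in \<gamma>. \<xi> (c *\<^sub>R f + d *\<^sub>R g) x = c * \<xi> f x + d * \<xi> g x" if "f \<in> E" "g \<in> E" for f g c d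
      using type that unfolding AE_measure_type[OF \<gamma>] gaussian_type_def by blast
  qed (use sub distr in auto)
  then show thesis using that \<gamma> by blast
qed

section \<open>Normalized block vectors and the contradiction\<close>

context monotone_covariance_kernel
begin

text \<open>The factor is chosen to make the norms at most 1. The value 0 for \<open>i >= n\<close>
  serves \<open>pair_statistic_le\<close>, whose hypotheses on the vectors range over all
  indices.\<close>

definition unit_block :: "nat \<Rightarrow> nat \<Rightarrow> 'g" where
  "unit_block n i = (if i < n then J (\<lambda>x. sqrt (real n / C) * indicator (block n i) x) else 0)"

lemma unit_block_eq:
  assumes "i < n"
  shows "unit_block n i = sqrt (real n / C) *\<^sub>R J (indicator (block n i))"
  using J_lincomb[OF block_L2[OF assms] zero_L2, of "sqrt (real n / C)" 0] assms by (simp add: unit_block_def)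

lemma unit_block_mem: "i < n \<Longrightarrow> unit_block n i \<in> G_space J (real i / real n) (real (Suc i) / real n)"
proof -
  assume i: "i < n"
  have "(\<lambda>x. sqrt (real n / C) * indicator (block n i) x + 0 * indicator (block n i) x) \<in> L2_interval (real i / real n) (real (Suc i) / real n)"
    by (intro L2_interval_lincomb indicator_L2_interval) (auto simp: block_def)
  then show ?thesis
    using i closure_subset[of "J ` L2_interval (real i / real n) (real (Suc i) / real n)"]
    by (auto simp: unit_block_def G_space_def)
qed

lemma unit_block_mem': "unit_block n i \<in> G_space J 0 1"
proof (cases "i < n")
  case True
  then have "G_space J (real i / real n) (real (Suc i) / real n) \<subseteq> G_space J 0 1"
    by (intro G_space_mono) (auto simp: divide_le_eq)
  then show ?thesis using unit_block_mem[OF True] by blast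
next
  case False
  then show ?thesis using subspace_0[OF subspace_G_space] by (simp add: unit_block_def)
qed

lemma inner_unit_block:
  assumes "i < n" "j < n"
  shows "unit_block n i \<bullet> unit_block n j = real n / C * (J (indicator (block n i)) \<bullet> J (indicator (block n j)))"
proof -
  have "unit_block n i \<bullet> unit_block n j = (sqrt (real n / C))\<^sup>2 * (J (indicator (block n i)) \<bullet> J (indicator (block n j)))"
    by (simp only: unit_block_eq assms inner_scaleR_left inner_scaleR_right power2_eq_square mult.assoc)
  then show ?thesis using C(1) by simp
qed

lemma unit_block_nonneg: "0 \<le> unit_block n i \<bullet> unit_block n j"
proof (cases "i < n \<and> j < n")
  case True
  then show ?thesis using C(1) by (simp add: inner_unit_block J_inner_nonneg block_L2)
qed (auto simp: unit_block_def)

lemma norm_unit_block_le: "0 < C \<Longrightarrow> norm (unit_block n i) \<le> 1"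
proof (cases "i < n")
  case True
  assume C: "0 < C"
  have "(norm (unit_block n i))\<^sup>2 = real n / C * (norm (J (indicator (block n i))))\<^sup>2"
    by (simp add: power2_norm_eq_inner inner_unit_block True)
  also have "\<dots> \<le> real n / C * (C / n)" using C by (intro mult_left_mono norm_block_le True) auto
  also have "\<dots> = 1" using C True by simp
  finally show ?thesis by (simp add: abs_square_le_1)
qed (simp add: unit_block_def)

lemma sum_unit_block_le:
  assumes "0 < C" "0 < n"
  shows "(\<Sum>i<n. \<Sum>j<n. unit_block n i \<bullet> unit_block n j) \<le> real n"
proof -
  have "(\<Sum>i<n. \<Sum>j<n. unit_block n i \<bullet> unit_block n j) =
      real n / C * (\<Sum>i<n. \<Sum>j<n. J (indicator (block n i)) \<bullet> J (indicator (block n j)))"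
    by (simp add: inner_unit_block sum_distrib_left)
  also have "\<dots> \<le> real n / C * C" using assms by (intro mult_left_mono sum_inner_block_le) auto
  finally show ?thesis using assms by simp
qed

text \<open>With \<open>n = 2 * m\<close> the blocks have length \<open>h = 1 / (2 * m)\<close>;
  hence \<open>2 * h = 1 / m\<close>, and the normalization gives
  \<open>n * h^2 / C = 1 / (2 * m * C)\<close>.\<close>

lemma unit_block_adjacent:
  assumes C: "0 < C" and k: "k < m"
  shows "B (1 / real m) / (2 * real m * C) \<le> unit_block (2 * m) (2 * k) \<bullet> unit_block (2 * m) (2 * k + 1)"
proof -
  let ?n = "2 * m" and ?i = "2 * k"
  let ?h = "1 / real ?n" and ?a = "real ?i / real ?n"
  have m: "0 < real m" using k by simp
  have "real (k + 1) \<le> real m" using k by (subst of_nat_le_iff) simp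
  then have k1: "2 * (real k + 1) \<le> 2 * real m" by simp
  have b: "block ?n ?i = {?a<..<?a + ?h}" "block ?n (?i + 1) = {?a + ?h<..<?a + 2 * ?h}"
    by (simp_all add: block_def add_divide_distrib add_ac)
  have "?h\<^sup>2 * B (2 * ?h) \<le> J (indicator (block ?n ?i)) \<bullet> J (indicator (block ?n (?i + 1)))"
    unfolding b using m k1 by (intro J_inner_adjacent) (auto simp: field_simps)
  then have "real ?n / C * (?h\<^sup>2 * B (2 * ?h)) \<le>
      real ?n / C * (J (indicator (block ?n ?i)) \<bullet> J (indicator (block ?n (?i + 1))))"
    by (rule mult_left_mono) (use C in simp)
  also have "\<dots> = unit_block ?n ?i \<bullet> unit_block ?n (?i + 1)"
    using k by (subst inner_unit_block) auto
  finally have "real ?n / C * (?h\<^sup>2 * B (2 * ?h)) \<le> unit_block ?n ?i \<bullet> unit_block ?n (?i + 1)" .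
  moreover have "real ?n / C * (?h\<^sup>2 * B (2 * ?h)) = B (1 / real m) / (2 * real m * C)"
    using m C by (simp add: field_simps power2_eq_square)
  ultimately show ?thesis by simp
qed

text \<open>Each sine is measurable for the field of its own grid interval, so independence passes
  from the fields to these variables.\<close>

lemma indep_vars_unit_block:
  assumes \<mu>: "prob_space \<mu>" "sets \<mu> = sets (G_measure J M \<xi> 0 1)"
    and ind: "prob_space.indep_sets \<mu> (\<lambda>i. sets (G_field J M \<xi> (real i / real n) (real (Suc i) / real n))) {..<n}"
  shows "prob_space.indep_vars \<mu> (\<lambda>_. borel) (\<lambda>i x. sin (\<xi> (unit_block n i) x)) {..<n}"
proof -
  interpret prob_space \<mu> by fact
  let ?F = "\<lambda>i. G_field J M \<xi> (real i / real n) (real (Suc i) / real n)"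
  let ?\<theta> = "\<lambda>i x. sin (\<xi> (unit_block n i) x)"
  have sp: "space \<mu> = space (?F i)" for i
    using sets_eq_imp_space_eq[OF \<mu>(2)] by (simp add: G_field_def G_measure_def space_restr_to_subalg)
  have meas: "?\<theta> i \<in> borel_measurable (?F i)" if "i < n" for i
  proof -
    have "\<xi> (unit_block n i) \<in> borel_measurable (?F i)"
      unfolding G_field_def by (intro measurable_gen_field unit_block_mem that)
    then show ?thesis by measurable
  qed
  have sub: "{?\<theta> i -` A \<inter> space \<mu> |A. A \<in> sets borel} \<subseteq> sets (?F i)" if "i < n" for i
    unfolding sp[of i] using meas[OF that] by (auto intro: measurable_sets)
  have "random_variable borel (?\<theta> i)" if i: "i < n" for i
  proof (rule measurable_from_subalg[OF _ meas[OF i]])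
    have "sets (?F i) \<subseteq> events" using ind i by (auto simp: indep_sets_def)
    then show "subalgebra \<mu> (?F i)" using sp[of i] by (simp add: subalgebra_def)
  qed
  moreover have "indep_sets (\<lambda>i. {?\<theta> i -` A \<inter> space \<mu> |A. A \<in> sets borel}) {..<n}"
    by (rule indep_sets_mono_sets[OF ind]) (use sub in auto)
  ultimately show ?thesis by (auto simp: indep_vars_def2)
qed

text \<open>The hypothesis on \<open>r\<close> makes both error probabilities, which are of order \<open>m / (B (1 / m))\<^sup>2\<close>,
  summable along the sequence \<open>r\<close>.\<close>

lemma no_unit:
  assumes sys: "product_system_of B J M \<xi>" and C: "0 < C"
    and r: "\<And>j. 0 < r j" "\<And>j. 0 < B (1 / r j)" "summable (\<lambda>j :: nat. real (r j) / (B (1 / r j))\<^sup>2)"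
  shows "\<not> is_system_unit J M \<xi> \<psi>"
proof
  assume unit: "is_system_unit J M \<xi> \<psi>"
  let ?Q = "G_measure J M \<xi> 0 1"
  have "gaussian_type (G_space J 0 1) (G_admissible J 0 1) ?Q \<xi>"
    using sys by (simp add: product_system_of_def)
  then obtain \<gamma> where \<gamma>: "\<gamma> \<in> measure_type ?Q" and "gaussian_field \<gamma> (G_space J 0 1) \<xi>"
    using gaussian_field_of_type norm_admissible subspace_G_space by blast
  then interpret \<gamma>: gaussian_field \<gamma> "G_space J 0 1" \<xi> by simp
  obtain \<mu> where \<mu>: "prob_space \<mu>" "sets \<mu> = sets ?Q" "absolutely_continuous ?Q \<mu>"
    "\<And>n. 0 < n \<Longrightarrow> prob_space.indep_sets \<mu>
      (\<lambda>i. sets (G_field J M \<xi> (real i / real n) (real (Suc i) / real n))) {..<n}"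
    using system_unit_indep_measure[OF sys unit] by blast
  interpret \<mu>: prob_space \<mu> by fact
  have s: "sets \<mu> = sets \<gamma>" using \<gamma> \<mu>(2) by (simp add: measure_type_def)
  have sp: "space \<mu> = space \<gamma>" by (rule sets_eq_imp_space_eq[OF s])
  have ac: "absolutely_continuous \<gamma> \<mu>"
    using \<gamma> \<mu>(3) by (auto simp: measure_type_def absolutely_continuous_def)
  define \<theta> where "\<theta> m i x = sin (\<xi> (unit_block (2 * m) i) x)" for m i x
  define W where "W m = pair_statistic m (\<lambda>i. sgn (\<mu>.expectation (\<theta> m i))) (\<theta> m)" for m
  \<comment> \<open>This is \<open>m * \<rho> / (2 * exp 1)\<close> for the correlation bound
    \<open>\<rho> = B (1 / m) / (2 * m * C)\<close> of adjacent blocks, half of the lower bound for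
    the mean under \<open>\<gamma>\<close>.\<close>
  define L where "L m = B (1 / m) / (4 * exp 1 * C)" for m :: nat
  have \<theta>_meas: "\<theta> m i \<in> borel_measurable \<gamma>" for m i
    unfolding \<theta>_def using \<gamma>.\<xi>_measurable[OF unit_block_mem'[of "2 * m" i]] by measurable
  have W_meas: "W m \<in> borel_measurable \<gamma>" for m
    unfolding W_def by (intro pair_statistic_measurable \<theta>_meas)
  have L: "0 < L (r j)" for j unfolding L_def using r(2) C by simp
  have \<gamma>_bound: "\<gamma>.prob {x \<in> space \<gamma>. W (r j) x < L (r j)} \<le> 4 * real (2 * r j) / (L (r j))\<^sup>2" for j
    unfolding W_def \<theta>_def
  proof (rule \<gamma>.pair_statistic_le[OF unit_block_mem' norm_unit_block_le[OF C] unit_block_nonneg])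
    show "(\<Sum>i<2 * r j. \<Sum>k<2 * r j. unit_block (2 * r j) i \<bullet> unit_block (2 * r j) k) \<le> real (2 * r j)"
      using r(1) C by (intro sum_unit_block_le) auto
    show "B (1 / r j) / (2 * r j * C) \<le> unit_block (2 * r j) (2 * k) \<bullet> unit_block (2 * r j) (2 * k + 1)"
      if "k < r j" for k using unit_block_adjacent[OF C that] by simp
    show "\<bar>sgn y\<bar> \<le> (1 :: real)" for y by (simp add: sgn_if)
    show "L (r j) = r j * (B (1 / r j) / (2 * r j * C)) / (2 * exp 1)"
      using r(1)[of j] by (simp add: L_def)
  qed (rule L)
  have \<mu>_bound: "\<mu>.prob {x \<in> space \<mu>. L (r j) \<le> W (r j) x} \<le> 6 * real (r j) / (L (r j))\<^sup>2" for j
    unfolding W_def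
  proof (rule \<mu>.indep_vars_pair_statistic)
    show "\<mu>.indep_vars (\<lambda>_. borel) (\<theta> (r j)) {..<2 * r j}"
      unfolding \<theta>_def using r(1)[of j] by (intro indep_vars_unit_block[OF \<mu>(1,2) \<mu>(4)]) auto
    show "\<bar>\<theta> (r j) i x\<bar> \<le> 1" for i x by (simp add: \<theta>_def)
  qed (rule L)
  \<comment> \<open>The constant \<open>8 = 4 * 2\<close> comes from the bound under
    \<open>\<gamma>\<close> with \<open>R = 2 * r j\<close>. The bound under \<open>\<mu>\<close>
    has the smaller constant 6, so one series dominates both.\<close>
  define D where "D = 8 * (4 * exp 1 * C)\<^sup>2"
  have summ: "summable (\<lambda>j. D * (real (r j) / (B (1 / r j))\<^sup>2))" using r(3) by (rule summable_mult)
  have b1: "4 * real (2 * r j) / (L (r j))\<^sup>2 \<le> D * (real (r j) / (B (1 / r j))\<^sup>2)" for j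
    by (simp add: D_def L_def power_divide mult_ac)
  have b2: "6 * real (r j) / (L (r j))\<^sup>2 \<le> 4 * real (2 * r j) / (L (r j))\<^sup>2" for j
    by (intro divide_right_mono) auto
  have compl: "space \<gamma> - {x \<in> space \<gamma>. W (r j) x < L (r j)} = {x \<in> space \<mu>. L (r j) \<le> W (r j) x}" for j
    by (auto simp: sp)
  show False
  proof (rule separating_events[OF \<gamma>.prob_space_axioms \<mu>(1) s ac, where A = "\<lambda>j. {x \<in> space \<gamma>. W (r j) x < L (r j)}"])
    show "{x \<in> space \<gamma>. W (r j) x < L (r j)} \<in> sets \<gamma>" for j using W_meas by measurable
    show "summable (\<lambda>j. \<gamma>.prob {x \<in> space \<gamma>. W (r j) x < L (r j)})"
      by (rule summable_comparison_test'[OF summ])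
        (use order_trans[OF \<gamma>_bound b1] in auto)
    show "summable (\<lambda>j. \<mu>.prob (space \<gamma> - {x \<in> space \<gamma>. W (r j) x < L (r j)}))"
      unfolding compl
      by (rule summable_comparison_test'[OF summ])
        (use order_trans[OF \<mu>_bound order_trans[OF b2 b1]] in auto)
  qed
qed

end

text \<open>The analytic hypotheses enter here: convexity yields measurability of \<open>B\<close>,
  \<open>\<alpha> > 1\<close> yields integrability at the origin, and the explicit formula yields a
  sequence \<open>r\<close> as required by \<open>no_unit\<close>.\<close>

theorem proposition10p8:
  fixes \<alpha> :: real and B :: "real \<Rightarrow> real"
    and J :: "(real \<Rightarrow> real) \<Rightarrow> 'g::{real_inner, complete_space}"
    and M :: "'w measure" and \<xi> :: "'g \<Rightarrow> 'w \<Rightarrow> real"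
  assumes "1 < \<alpha>"
    and "\<forall>t. t \<noteq> 0 \<longrightarrow> B (- t) = B t"
    and "\<forall>t>0. 0 \<le> B t"
    and "antimono_on {0<..} B"
    and "convex_on {0<..} B"
    and "\<exists>\<epsilon>>0. \<forall>t. 0 < t \<and> t < \<epsilon> \<longrightarrow> B t = 1 / (t * ln (1 / t) powr \<alpha>)"
    and "product_system_of B J M \<xi>"
  shows "\<not> (\<exists>\<psi>. is_system_unit J M \<xi> \<psi>)"
proof -
  obtain \<epsilon> where \<epsilon>: "0 < \<epsilon>" "\<And>t. 0 < t \<Longrightarrow> t < \<epsilon> \<Longrightarrow> B t = 1 / (t * ln (1 / t) powr \<alpha>)"
    using assms(6) by blast
  define \<delta> where "\<delta> = min \<epsilon> (1 / 2)"
  have \<delta>: "0 < \<delta>" "\<delta> < 1" "\<delta> \<le> \<epsilon>" using \<epsilon>(1) by (auto simp: \<delta>_def)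
  have even: "B (- t) = B t" if "t \<noteq> 0" for t using assms(2) that by blast
  have nonneg: "0 \<le> B t" if "0 < t" for t using assms(3) that by blast
  have meas: "B \<in> borel_measurable borel" using even assms(5) by (rule borel_measurable_even_convex)
  have "set_integrable lborel {0<..<\<delta>} B \<longleftrightarrow> set_integrable lborel {0<..<\<delta>} (\<lambda>t. 1 / (t * ln (1 / t) powr \<alpha>))"
    using \<epsilon>(2) \<delta>(3) by (intro set_integrable_cong) auto
  then have int: "set_integrable lborel {0<..<\<delta>} B"
    using set_integrable_inverse_ln_powr[OF assms(1) \<delta>(1,2)] by simp
  define K where "K = (\<integral>\<^sup>+x. ennreal \<bar>B x\<bar> * indicator {-1<..<1} x \<partial>lborel)"
  have K: "K < \<infinity>"
    unfolding K_def by (rule nn_integral_even_kernel_finite[OF meas even nonneg assms(4) \<delta>(1) int])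
  \<comment> \<open>Adding 1 makes the bound strictly positive, as the normalization divides by
    it.\<close>
  define C where "C = enn2real K + 1"
  have C_pos: "0 < C" by (simp add: C_def add_nonneg_pos)
  have KC: "K \<le> ennreal C" using K by (cases K) (auto simp: C_def)
  interpret monotone_covariance_kernel B J C
    using assms(4,7) meas even nonneg C_pos KC
    by unfold_locales (auto simp: product_system_of_def K_def)
  \<comment> \<open>The second condition puts every \<open>1 / r j\<close> into the range where the
    formula for \<open>B\<close> holds; the first gives \<open>r j > 1\<close>, so that the
    logarithm is positive.\<close>
  obtain N where N: "0 < N" "1 / \<epsilon> < 4 ^ N"
  proof -
    obtain N where "1 / \<epsilon> < 4 ^ N" using real_arch_pow[of 4 "1 / \<epsilon>"] by auto
    then show thesis using that[of "Suc N"] by (simp add: order_less_le_trans)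
  qed
  \<comment> \<open>Geometric growth makes \<open>ln (r j) powr (2 * \<alpha>) / r j\<close>
    summable, and powers of 4 have the exact square roots \<open>2 ^ (N + j)\<close>.\<close>
  define r where "r j = (4 :: nat) ^ (N + j)" for j
  have r1: "1 < real (r j)" for j
  proof -
    have "1 < r j" unfolding r_def using N(1) by (intro one_less_power) auto
    then show ?thesis by simp
  qed
  have rB: "B (1 / r j) = r j / ln (r j) powr \<alpha>" for j
  proof -
    have "1 / \<epsilon> < 4 ^ N" by (rule N)
    also have "\<dots> \<le> real (r j)" by (simp add: r_def power_increasing)
    finally have "1 / r j < \<epsilon>" using \<epsilon>(1) r1[of j] by (simp add: field_simps)
    then show ?thesis using \<epsilon>(2)[of "1 / r j"] r1[of j] by simp
  qed
  have r: "0 < B (1 / r j)" for j using r1[of j] by (simp add: rB)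
  \<comment> \<open>The square root of the constant in \<open>ln x powr a <= a powr a * x\<close>
    for \<open>a = 4 * \<alpha>\<close>. Taking roots bounds the power \<open>2 * \<alpha>\<close>
    of the logarithm by \<open>c\<close> times the square root of \<open>r j\<close>, which leaves a
    geometric series with ratio \<open>1 / 2\<close>.\<close>
  define c where "c = (4 * \<alpha>) powr (2 * \<alpha>)"
  have bound: "real (r j) / (B (1 / r j))\<^sup>2 \<le> c * (1 / 2) ^ j" for j
  proof -
    let ?r = "real (r j)"
    have sq: "sqrt ?r = 2 ^ (N + j)"
      by (simp add: r_def real_sqrt_power)
    have "ln ?r powr (4 * \<alpha>) \<le> (4 * \<alpha>) powr (4 * \<alpha>) * ?r"
      using r1 assms(1) by (intro ln_powr_bound2) auto
    then have "sqrt (ln ?r powr (4 * \<alpha>)) \<le> sqrt ((4 * \<alpha>) powr (4 * \<alpha>) * ?r)"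
      by (rule real_sqrt_le_mono)
    moreover have half: "sqrt (y powr (4 * \<alpha>)) = y powr (2 * \<alpha>)" if "0 < y" for y :: real
      using that by (simp add: powr_half_sqrt[symmetric] powr_powr)
    ultimately have "ln ?r powr (2 * \<alpha>) \<le> c * 2 ^ (N + j)"
      using r1[of j] assms(1) by (simp add: c_def real_sqrt_mult sq)
    have "?r / (B (1 / r j))\<^sup>2 = ln ?r powr (2 * \<alpha>) / ?r"
      using r1[of j] by (simp add: rB power_divide power2_eq_square powr_add[symmetric])
    also have "\<dots> \<le> c * 2 ^ (N + j) / ?r"
      using r1[of j] \<open>ln ?r powr (2 * \<alpha>) \<le> c * 2 ^ (N + j)\<close> by (intro divide_right_mono) auto
    also have "\<dots> = c * (1 / 2) ^ (N + j)"
      by (simp add: r_def power_divide field_simps flip: power_mult_distrib)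
    also have "\<dots> \<le> c * (1 / 2) ^ j"
      by (intro mult_left_mono power_decreasing) (auto simp: c_def)
    finally show ?thesis .
  qed
  have "summable (\<lambda>j. real (r j) / (B (1 / r j))\<^sup>2)"
    by (rule summable_comparison_test'[of "\<lambda>j. c * (1 / 2) ^ j"])
      (use bound in \<open>auto intro!: summable_mult summable_geometric\<close>)
  then have "\<not> is_system_unit J M \<xi> \<psi>" for \<psi>
    using r r1 by (intro no_unit[OF assms(7) C_pos, of r]) (auto simp: r_def)
  then show ?thesis by blast
qed

end
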